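(* Let $n\ge 1$, let $\|\cdot\|$ be a norm on $\mathbb{C}^n$ and let $E=(\mathbb{C}^n,\|\cdot\|)$, with open unit ball $B$ and unit sphere $S$. Then the set of all $f\in\mathcal{H}^\infty(B)$ for which there exists a disk centered at the origin (depending on $f$ but not on $z$) which is contained in $Cl(f,z)$ for every $z\in S$ is strongly $\mathfrak{c}$-algebrable (as a subset of the algebra $\mathcal{H}^\infty(B)$).
   Context: $\mathcal{H}^\infty(B)$ is the algebra of all bounded holomorphic functions $f:B\to\mathbb{C}$. For $f\in\mathcal{H}^\infty(B)$ and $z\in\overline{B}$, the cluster set $Cl(f,z)$ is the set of all $\lambda\in\mathbb{C}$ for which there is a sequence $(x_k)\subset B$ with $x_k\to z$ and $f(x_k)\to\lambda$. A disk means a disk in $\mathbb{C}$ of positive radius. $\mathfrak{c}$ is the cardinality of the continuum. A subset $G=\{x_i:i\in I\}$ of a complex commutative algebra $\mathcal{A}$ is algebraically independent if for every $n\in\mathbb{N}$, every polynomial $Q\in\mathbb{C}[z_1,\dots,z_n]$ and all distinct indices $i_1,\dots,i_n\in I$, $Q(x_{i_1},\dots,x_{i_n})=0$ implies $Q=0$. If $\mathcal{A}$ is an algebra of complex-valued functions on a set and $\kappa$ is a cardinal, a subset $M\subset\mathcal{A}$ is strongly $\kappa$-algebrable if there is a sub-algebra $\mathcal{B}$ of $\mathcal{A}$ generated by an infinite algebraically independent set of generators of cardinality $\kappa$ and such that $\mathcal{B}\subset M\cup\{0\}$. Here the generated sub-algebra is not required to contain the unit: it consists of all values $Q(x_{i_1},\dots,x_{i_n})$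 of polynomials $Q$ without constant term at generators. *)

theory Defs
  imports "HOL-Analysis.Analysis" "HOL-Library.Poly_Mapping"
begin

unbundle cardinal_syntax

section \<open>Algebras of functions and strong algebrability\<close>

text \<open>
  A complex-valued function on a set \<open>X\<close> is an extensional function, i.e. one that takes the
  fixed value \<^term>\<open>undefined\<close> off \<open>X\<close>, so that HOL equality is equality of functions on \<open>X\<close>.
  The algebra operations are pointwise on \<open>X\<close>, and the zero element is \<open>\<lambda>x\<in>X. 0\<close>.

  A polynomial over the complex numbers is a finitely supported map from exponent vectors to
  coefficients.  Variables are numbered from \<open>0\<close>.
\<close>

type_synonym cpoly = "(nat \<Rightarrow>\<^sub>0 nat) \<Rightarrow>\<^sub>0 complex"

definition polys_in :: "nat \<Rightarrow> cpoly set" where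
  "polys_in n = {Q. \<forall>m\<in>Poly_Mapping.keys Q. Poly_Mapping.keys m \<subseteq> {..<n}}"

definition poly_val :: "cpoly \<Rightarrow> (nat \<Rightarrow> complex) \<Rightarrow> complex" where
  "poly_val Q a = (\<Sum>m\<in>Poly_Mapping.keys Q.
      Poly_Mapping.lookup Q m * (\<Prod>i\<in>Poly_Mapping.keys m. a i ^ Poly_Mapping.lookup m i))"

definition poly_fun :: "'x set \<Rightarrow> cpoly \<Rightarrow> (nat \<Rightarrow> 'x \<Rightarrow> complex) \<Rightarrow> 'x \<Rightarrow> complex" where
  "poly_fun X Q g = (\<lambda>x\<in>X. poly_val Q (\<lambda>i. g i x))"

definition alg_independent :: "'x set \<Rightarrow> ('x \<Rightarrow> complex) set \<Rightarrow> bool" where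
  "alg_independent X G \<longleftrightarrow>
    (\<forall>n. \<forall>Q\<in>polys_in n. \<forall>g. inj_on g {..<n} \<and> g ` {..<n} \<subseteq> G \<and> poly_fun X Q g = (\<lambda>x\<in>X. 0)
      \<longrightarrow> Q = 0)"

text \<open>The generated sub-algebra need not contain the unit: \<open>Poly_Mapping.lookup Q 0\<close> is the
  constant term of \<open>Q\<close>.\<close>

definition generated_subalgebra :: "'x set \<Rightarrow> ('x \<Rightarrow> complex) set \<Rightarrow> ('x \<Rightarrow> complex) set" where
  "generated_subalgebra X G =
    {poly_fun X Q g | n Q g. Q \<in> polys_in n \<and> Poly_Mapping.lookup Q 0 = 0 \<and> g ` {..<n} \<subseteq> G}"

definition strongly_algebrable ::
    "'k rel \<Rightarrow> 'x set \<Rightarrow> ('x \<Rightarrow> complex) set \<Rightarrow> ('x \<Rightarrow> complex) set \<Rightarrow> bool" where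
  "strongly_algebrable \<kappa> X A M \<longleftrightarrow>
    M \<subseteq> A \<and>
    (\<exists>G \<subseteq> A. infinite G \<and> |G| =o \<kappa> \<and> alg_independent X G \<and>
      generated_subalgebra X G \<subseteq> M \<union> {\<lambda>x\<in>X. 0})"


section \<open>Norms on complex n-space\<close>

definition is_cnorm :: "(complex ^ 'n \<Rightarrow> real) \<Rightarrow> bool" where
  "is_cnorm N \<longleftrightarrow>
    (\<forall>x. 0 \<le> N x) \<and> (\<forall>x. N x = 0 \<longleftrightarrow> x = 0) \<and>
    (\<forall>c x. N (c *s x) = cmod c * N x) \<and> (\<forall>x y. N (x + y) \<le> N x + N y)"

definition norm_ball :: "(complex ^ 'n \<Rightarrow> real) \<Rightarrow> (complex ^ 'n) set" where
  "norm_ball N = {x. N x < 1}"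

definition norm_sphere :: "(complex ^ 'n \<Rightarrow> real) \<Rightarrow> (complex ^ 'n) set" where
  "norm_sphere N = {x. N x = 1}"

text \<open>
  Every norm induces the standard topology of complex n-space, so convergence and
  differentiability below are the library notions for \<^typ>\<open>complex ^ 'n\<close>.
\<close>

lemma is_cnorm_equiv:
  fixes N :: "complex ^ 'n \<Rightarrow> real"
  assumes "is_cnorm N"
  obtains c C where "c > 0" "C > 0" "\<And>x. c * norm x \<le> N x" "\<And>x. N x \<le> C * norm x"
proof -
  have nn: "0 \<le> N x" and z: "N x = 0 \<longleftrightarrow> x = 0" and h: "N (a *s x) = cmod a * N x"
    and t: "N (x + y) \<le> N x + N y" for x y a
    using assms unfolding is_cnorm_def by auto
  have tsum: "N (sum f I) \<le> (\<Sum>i\<in>I. N (f i))" if "finite I" for f and I :: "'n set"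
    using that
  proof (induction I rule: finite_induct)
    case empty then show ?case using z[of 0] by simp
  next
    case (insert i I)
    then show ?case using t[of "f i" "sum f I"] by simp
  qed
  define C where "C = 1 + (\<Sum>i\<in>UNIV. N (axis i 1))"
  have C: "C > 0" unfolding C_def by (simp add: add_pos_nonneg sum_nonneg nn)
  have up: "N x \<le> C * norm x" for x
  proof -
    have "N x = N (\<Sum>i\<in>UNIV. (x $ i) *s axis i 1)" by (simp add: basis_expansion)
    also have "\<dots> \<le> (\<Sum>i\<in>UNIV. cmod (x $ i) * N (axis i 1))"
      using tsum[of UNIV "\<lambda>i. (x $ i) *s axis i 1"] by (simp add: h)
    also have "\<dots> \<le> (\<Sum>i\<in>UNIV. norm x * N (axis i 1))"
      by (intro sum_mono mult_right_mono nn) (simp add: Finite_Cartesian_Product.norm_nth_le)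
    also have "\<dots> \<le> C * norm x" unfolding C_def by (simp add: algebra_simps sum_distrib_left)
    finally show ?thesis .
  qed
  have neg: "N (- x) = N x" for x
    using h[of "-1" x] by simp
  have lip: "\<bar>N x - N y\<bar> \<le> C * dist x y" for x y
  proof -
    have "N x \<le> N (x - y) + N y" "N y \<le> N (y - x) + N x"
      using t[of "x - y" y] t[of "y - x" x] by auto
    moreover have "N (y - x) = N (x - y)" using neg[of "x - y"] by simp
    ultimately show ?thesis using up[of "x - y"] by (auto simp: dist_norm)
  qed
  have cont: "continuous_on UNIV N"
    unfolding continuous_on_iff
  proof (intro ballI allI impI)
    fix x :: "complex ^ 'n" and e :: real assume "e > 0"
    then show "\<exists>d>0. \<forall>y\<in>UNIV. dist y x < d \<longrightarrow> dist (N y) (N x) < e"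
      using C lip by (intro exI[of _ "e / C"])
        (auto simp: dist_real_def field_simps intro: le_less_trans)
  qed
  obtain x0 :: "complex ^ 'n" where x0: "x0 \<in> sphere 0 1" "\<And>y. y \<in> sphere 0 1 \<Longrightarrow> N x0 \<le> N y"
    using continuous_attains_inf[OF compact_sphere, of 0 1 N] cont
    by (metis continuous_on_subset subset_UNIV sphere_eq_empty zero_le_one not_less)
  have pos: "N x0 > 0" using x0(1) z[of x0] nn[of x0] by (auto simp: less_le)
  have low: "N x0 * norm x \<le> N x" for x
  proof (cases "x = 0")
    case False
    have eq: "(1 / norm x) *\<^sub>R x = complex_of_real (1 / norm x) *s x"
      unfolding vec_eq_iff vector_scaleR_component vector_smult_component
      by (simp only: scaleR_conv_of_real) simp
    have "N x0 \<le> N ((1 / norm x) *\<^sub>R x)"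
      using False by (intro x0(2)) simp
    also have "\<dots> = N x / norm x" unfolding eq h by (simp add: norm_divide)
    finally show ?thesis using False by (simp add: field_simps)
  qed (simp add: nn)
  show ?thesis using that[OF pos C low up] .
qed

lemma is_cnorm_tendsto_iff:
  fixes N :: "complex ^ 'n \<Rightarrow> real"
  assumes "is_cnorm N"
  shows "(x \<longlonglongrightarrow> z) \<longleftrightarrow> (\<lambda>k. N (x k - z)) \<longlonglongrightarrow> 0"
proof -
  obtain c C where c: "c > 0" "C > 0" "\<And>x. c * norm x \<le> N x" "\<And>x. N x \<le> C * norm x"
    using is_cnorm_equiv[OF assms] by blast
  have nn: "0 \<le> N x" for x using assms unfolding is_cnorm_def by auto
  have "(\<lambda>k. N (x k - z)) \<longlonglongrightarrow> 0" if "(\<lambda>k. norm (x k - z)) \<longlonglongrightarrow> 0"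
    by (rule tendsto_sandwich[OF _ _ tendsto_const tendsto_mult_right_zero[OF that, of C]])
      (auto simp: nn c)
  moreover have "(\<lambda>k. norm (x k - z)) \<longlonglongrightarrow> 0" if "(\<lambda>k. N (x k - z)) \<longlonglongrightarrow> 0"
  proof (rule tendsto_sandwich[OF _ _ tendsto_const tendsto_mult_right_zero[OF that, of "1 / c"]])
    show "\<forall>\<^sub>F k in sequentially. norm (x k - z) \<le> 1 / c * N (x k - z)"
      using c(1) c(3) by (auto simp: field_simps)
  qed auto
  ultimately show ?thesis
    unfolding LIM_zero_iff[symmetric, of x z] tendsto_norm_zero_iff[symmetric, of "\<lambda>k. x k - z"]
    by blast
qed


section \<open>Bounded holomorphic functions and cluster sets\<close>

text \<open>For open \<open>B\<close>: complex Frechet differentiability at each point of \<open>B\<close>.\<close>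

definition cn_holomorphic_on :: "(complex ^ 'n \<Rightarrow> complex) \<Rightarrow> (complex ^ 'n) set \<Rightarrow> bool" where
  "cn_holomorphic_on f B \<longleftrightarrow>
    (\<forall>z\<in>B. \<exists>D. (f has_derivative D) (at z) \<and> (\<forall>c v. D (c *s v) = c * D v))"

definition Hinf :: "(complex ^ 'n) set \<Rightarrow> (complex ^ 'n \<Rightarrow> complex) set" where
  "Hinf B = {f \<in> extensional B. cn_holomorphic_on f B \<and> bounded (f ` B)}"

definition cluster_set ::
    "(complex ^ 'n) set \<Rightarrow> (complex ^ 'n \<Rightarrow> complex) \<Rightarrow> complex ^ 'n \<Rightarrow> complex set" where
  "cluster_set B f z = {l. \<exists>x. (\<forall>k::nat. x k \<in> B) \<and> x \<longlonglongrightarrow> z \<and> (\<lambda>k. f (x k)) \<longlonglongrightarrow> l}"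

end

theory Submission
  imports Defs "HOL-Complex_Analysis.Complex_Analysis"
begin

text \<open>
  Write \<open>B\<close> and \<open>S\<close> for the unit ball and the unit sphere of the norm \<open>N\<close>.  The generators are
  functions \<open>f \<tau>\<close>, one for each real \<open>\<tau>\<close>, which are bounded and holomorphic on \<open>B\<close> and whose joint
  boundary behaviour is as rich as possible: for every \<open>z\<close> in \<open>S\<close>, every finite set of indices \<open>\<tau>\<close>
  and every choice of targets \<open>c \<tau>\<close> in the closed unit disc there is one sequence in \<open>B\<close> that tends
  to \<open>z\<close> and along which \<open>f \<tau>\<close> tends to \<open>c \<tau>\<close> for all the chosen \<open>\<tau>\<close> at once
  (\<open>exists_universal_cluster_family\<close>).

  Everything follows from this.  Let \<open>p = Q(f \<tau>\<^sub>0, f \<tau>\<^sub>1, \<dots>)\<close>.  At every \<open>z\<close> in \<open>S\<close> the cluster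
  set of \<open>p\<close> contains the values of \<open>Q(c \<tau>\<^sub>0, c \<tau>\<^sub>1, \<dots>)\<close> for all targets \<open>c\<close>.  If \<open>p = 0\<close> and the
  indices are distinct, then \<open>Q\<close> vanishes on the unit polydisc, hence \<open>Q = 0\<close>.  If \<open>p\<close> is nonzero at
  some point \<open>x\<close> and \<open>Q\<close> has no constant term, then \<open>Q(u (f \<tau>\<^sub>0 x), u (f \<tau>\<^sub>1 x), \<dots>)\<close> is a
  nonconstant entire function of \<open>u\<close> that vanishes at \<open>0\<close>.  By the open mapping theorem it maps a
  small disc around \<open>0\<close>, where all arguments of \<open>Q\<close> stay in the closed unit disc, onto a set
  containing a disc around \<open>0\<close>; this disc does not depend on \<open>z\<close>.

  The family comes from an interpolation theorem (\<open>asymptotic_interpolation\<close>): near any given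
  sequence of points of \<open>S\<close> there are points \<open>x k\<close> in \<open>B\<close> such that for every sequence \<open>d\<close> in the
  closed unit disc some bounded holomorphic function has \<open>f (x k) - d k\<close> tending to \<open>0\<close>.  Take for
  \<open>d\<close> the coordinates of a countable dense subset of a product of continuum many discs
  (\<open>dense_family\<close>), each repeated infinitely often near each point of \<open>S\<close>.

  For the interpolation, a supporting functional \<open>L\<close> at \<open>a\<close> in \<open>S\<close> maps \<open>B\<close> into the unit disc and
  \<open>a\<close> to \<open>1\<close>, so that functions of \<open>L\<close> yield a peaking function \<open>h\<close>: close to \<open>1\<close> somewhere near
  \<open>a\<close>, very small on a prescribed smaller ball, and with values so close to the segment from \<open>0\<close> to
  \<open>1\<close> that \<open>\<bar>h\<bar> + \<bar>1 - h\<bar> \<le> 1 + \<epsilon>\<close>.  Replacing \<open>f\<close> by \<open>(1 - h) f + d h\<close> then corrects the value near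
  \<open>a\<close>, hardly changes \<open>f\<close> at the points treated before, and multiplies the bound on \<open>f\<close> by at most
  \<open>1 + \<epsilon>\<close>.  Merely adding multiples of peaking functions need not give a bounded sum, because the
  points \<open>a\<close> are dense in \<open>S\<close> and so infinitely many peaks overlap; an almost convex combination
  stays bounded however the peaks overlap.
\<close>

section \<open>Holomorphic functions of several variables\<close>

definition complex_linear :: "(complex ^ 'n \<Rightarrow> complex) \<Rightarrow> bool" where
  "complex_linear L \<longleftrightarrow> linear L \<and> (\<forall>c v. L (c *s v) = c * L v)"

lemma norm_vector_smult: "norm (c *s v) = cmod c * norm v" for v :: "complex ^ 'n"
  by (simp add: norm_vec_def norm_mult L2_set_right_distrib)

lemma scaleR_eq_smult: "r *\<^sub>R v = complex_of_real r *s v" for v :: "complex ^ 'n"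
  unfolding vec_eq_iff vector_scaleR_component vector_smult_component
  by (simp only: scaleR_conv_of_real) simp

lemma cn_holomorphic_onI:
  assumes "\<And>z. z \<in> B \<Longrightarrow> (f has_derivative D z) (at z)"
    and "\<And>z c v. z \<in> B \<Longrightarrow> D z (c *s v) = c * D z v"
  shows "cn_holomorphic_on f B"
  using assms unfolding cn_holomorphic_on_def by blast

lemma cn_holomorphic_on_const: "cn_holomorphic_on (\<lambda>z. c) B"
  by (rule cn_holomorphic_onI[where D = "\<lambda>z v. 0"]) auto

lemma complex_linear_imp_cn_holomorphic_on:
  assumes "complex_linear L"
  shows "cn_holomorphic_on L B"
  using assms unfolding complex_linear_def
  by (intro cn_holomorphic_onI[where D = "\<lambda>z. L"]) (auto intro: linear_imp_has_derivative)

lemma cn_holomorphic_on_add: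
  assumes "cn_holomorphic_on f B" "cn_holomorphic_on g B"
  shows "cn_holomorphic_on (\<lambda>z. f z + g z) B"
proof -
  obtain D where D: "\<And>z. z \<in> B \<Longrightarrow> (f has_derivative D z) (at z)"
    "\<And>z c v. z \<in> B \<Longrightarrow> D z (c *s v) = c * D z v"
    using assms(1) unfolding cn_holomorphic_on_def by metis
  obtain E where E: "\<And>z. z \<in> B \<Longrightarrow> (g has_derivative E z) (at z)"
    "\<And>z c v. z \<in> B \<Longrightarrow> E z (c *s v) = c * E z v"
    using assms(2) unfolding cn_holomorphic_on_def by metis
  show ?thesis
    using D E by (intro cn_holomorphic_onI[where D = "\<lambda>z v. D z v + E z v"])
      (auto intro!: has_derivative_add simp: algebra_simps)
qed

lemma cn_holomorphic_on_mult:
  assumes "cn_holomorphic_on f B" "cn_holomorphic_on g B"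
  shows "cn_holomorphic_on (\<lambda>z. f z * g z) B"
proof -
  obtain D where D: "\<And>z. z \<in> B \<Longrightarrow> (f has_derivative D z) (at z)"
    "\<And>z c v. z \<in> B \<Longrightarrow> D z (c *s v) = c * D z v"
    using assms(1) unfolding cn_holomorphic_on_def by metis
  obtain E where E: "\<And>z. z \<in> B \<Longrightarrow> (g has_derivative E z) (at z)"
    "\<And>z c v. z \<in> B \<Longrightarrow> E z (c *s v) = c * E z v"
    using assms(2) unfolding cn_holomorphic_on_def by metis
  show ?thesis
  proof (rule cn_holomorphic_onI)
    fix z assume z: "z \<in> B"
    show "((\<lambda>z. f z * g z) has_derivative (\<lambda>v. f z * E z v + D z v * g z)) (at z)"
      using D(1)[OF z] E(1)[OF z] by (rule has_derivative_mult)
    show "f z * E z (c *s v) + D z (c *s v) * g z = c * (f z * E z v + D z v * g z)" for c v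
      using D(2)[OF z] E(2)[OF z] by (simp add: algebra_simps)
  qed
qed

lemma cn_holomorphic_on_sum:
  assumes "\<And>i. i \<in> I \<Longrightarrow> cn_holomorphic_on (f i) B"
  shows "cn_holomorphic_on (\<lambda>z. \<Sum>i\<in>I. f i z) B"
  using assms
  by (induction I rule: infinite_finite_induct)
    (auto intro: cn_holomorphic_on_const cn_holomorphic_on_add)

lemma cn_holomorphic_on_prod:
  assumes "\<And>i. i \<in> I \<Longrightarrow> cn_holomorphic_on (f i) B"
  shows "cn_holomorphic_on (\<lambda>z. \<Prod>i\<in>I. f i z) B"
  using assms
  by (induction I rule: infinite_finite_induct)
    (auto intro: cn_holomorphic_on_const cn_holomorphic_on_mult)

lemma cn_holomorphic_on_power:
  assumes "cn_holomorphic_on f B"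
  shows "cn_holomorphic_on (\<lambda>z. f z ^ k) B"
  using assms
  by (induction k) (auto intro: cn_holomorphic_on_const cn_holomorphic_on_mult)

lemma cn_holomorphic_on_compose:
  assumes "cn_holomorphic_on f B" "\<phi> holomorphic_on W" "open W" "f ` B \<subseteq> W"
  shows "cn_holomorphic_on (\<lambda>z. \<phi> (f z)) B"
proof -
  obtain D where D: "\<And>z. z \<in> B \<Longrightarrow> (f has_derivative D z) (at z)"
    "\<And>z c v. z \<in> B \<Longrightarrow> D z (c *s v) = c * D z v"
    using assms(1) unfolding cn_holomorphic_on_def by metis
  have \<phi>: "(\<phi> has_derivative (*) (deriv \<phi> (f z))) (at (f z))" if "z \<in> B" for z
    using holomorphic_derivI[OF assms(2,3), of "f z"] assms(4) that
    by (auto simp: has_field_derivative_def)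
  show ?thesis
    using D has_derivative_compose[OF D(1) \<phi>]
    by (intro cn_holomorphic_onI[where D = "\<lambda>z v. deriv \<phi> (f z) * D z v"]) auto
qed

lemma cn_holomorphic_on_cong_open:
  assumes "cn_holomorphic_on f B" "open B" "\<And>z. z \<in> B \<Longrightarrow> f z = g z"
  shows "cn_holomorphic_on g B"
  using assms unfolding cn_holomorphic_on_def
  by (meson has_derivative_transform_within_open)

text \<open>
  Restrict \<open>F\<close> to the complex line through \<open>x\<close> in direction \<open>v\<close>: this reduces the bound to the
  Cauchy inequality in one variable.
\<close>

lemma Cauchy_derivative_bound:
  fixes x :: "complex ^ 'n"
  assumes F: "cn_holomorphic_on F U" and s: "s > 0" "ball x s \<subseteq> U"
    and bound: "\<And>y. y \<in> ball x s \<Longrightarrow> cmod (F y) \<le> M"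
    and D: "(F has_derivative D) (at x)"
  shows "cmod (D v) \<le> 2 * M / s * norm v"
proof (cases "v = 0")
  case True
  then show ?thesis using linear_0[OF has_derivative_linear[OF D]] by simp
next
  case False
  obtain E where E: "\<And>z. z \<in> U \<Longrightarrow> (F has_derivative E z) (at z)"
    "\<And>z c v. z \<in> U \<Longrightarrow> E z (c *s v) = c * E z v"
    using F unfolding cn_holomorphic_on_def by metis
  \<comment> \<open>half of the radius \<open>s / norm v\<close>, so that \<open>\<phi>\<close> is holomorphic beyond the circle of radius \<open>t\<close>\<close>
  define t where "t = s / (2 * norm v)"
  have t: "t > 0" using s False by (simp add: t_def)
  define \<phi> where "\<phi> w = F (x + w *s v)" for w
  have mem: "x + w *s v \<in> ball x s" if "cmod w < 2 * t" for w
    using that False by (simp add: dist_norm norm_vector_smult t_def field_simps)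
  have lin: "((\<lambda>w. x + w *s v) has_derivative (\<lambda>w. w *s v)) (at w)" for w
  proof -
    have "linear (\<lambda>w::complex. w *s v)"
      by (intro linearI) (auto simp: vec_eq_iff algebra_simps)
    from has_derivative_add[OF has_derivative_const linear_imp_has_derivative[OF this]]
    show ?thesis by simp
  qed
  have der: "(\<phi> has_field_derivative E (x + w *s v) v) (at w)" if "cmod w < 2 * t" for w
  proof -
    have U: "x + w *s v \<in> U" using mem[OF that] s by blast
    have "(\<phi> has_derivative (\<lambda>c. E (x + w *s v) (c *s v))) (at w)"
      unfolding \<phi>_def using has_derivative_compose[OF lin E(1)[OF U]] by simp
    also have "(\<lambda>c. E (x + w *s v) (c *s v)) = (*) (E (x + w *s v) v)"
      using E(2)[OF U] by (auto simp: mult.commute)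
    finally show ?thesis by (simp add: has_field_derivative_def)
  qed
  have hol: "\<phi> holomorphic_on ball 0 (2 * t)"
    unfolding holomorphic_on_def field_differentiable_def
    by (metis der has_field_derivative_at_within mem_ball_0)
  have "cmod ((deriv ^^ 1) \<phi> 0) \<le> fact 1 * M / t ^ 1"
  proof (rule Cauchy_inequality)
    show "\<phi> holomorphic_on ball 0 t"
      by (rule holomorphic_on_subset[OF hol]) (use t in auto)
    show "continuous_on (cball 0 t) \<phi>"
      by (rule holomorphic_on_imp_continuous_on, rule holomorphic_on_subset[OF hol]) (use t in auto)
    show "cmod (\<phi> w) \<le> M" if "cmod (0 - w) = t" for w
      unfolding \<phi>_def using that t by (intro bound mem) auto
  qed fact
  moreover have "deriv \<phi> 0 = D v"
  proof -
    have "x \<in> U" using s by auto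
    then have "E x = D" using E(1) D has_derivative_unique by blast
    then show ?thesis using DERIV_imp_deriv[OF der[of 0]] t by simp
  qed
  ultimately show ?thesis by (simp add: t_def field_simps)
qed

text \<open>
  The Weierstrass convergence theorem.  Cauchy estimates for the differences \<open>f m - f n\<close> make the
  derivatives uniformly Cauchy on a smaller ball, so that limit and derivative may be exchanged.
\<close>

lemma cn_holomorphic_on_locally_uniform_limit:
  fixes f :: "nat \<Rightarrow> complex ^ 'n \<Rightarrow> complex"
  assumes hol: "\<And>n. cn_holomorphic_on (f n) U"
    and lim: "\<And>z. z \<in> U \<Longrightarrow> \<exists>r>0. ball z r \<subseteq> U \<and> uniform_limit (ball z r) f g sequentially"
  shows "cn_holomorphic_on g U"
  unfolding cn_holomorphic_on_def
proof
  fix z assume z: "z \<in> U"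
  obtain r where r: "r > 0" "ball z r \<subseteq> U" "uniform_limit (ball z r) f g sequentially"
    using lim[OF z] by blast
  have "\<forall>n. \<exists>D. \<forall>z\<in>U. (f n has_derivative D z) (at z) \<and> (\<forall>c v. D z (c *s v) = c * D z v)"
    using hol unfolding cn_holomorphic_on_def by metis
  then obtain D where D: "\<And>n x. x \<in> U \<Longrightarrow> (f n has_derivative D n x) (at x)"
    "\<And>n x c v. x \<in> U \<Longrightarrow> D n x (c *s v) = c * D n x v"
    by metis
  define S where "S = ball z (r/2)"
  have SU: "x \<in> U" if "x \<in> S" for x
    using that r(1,2) by (auto simp: S_def)
  have sub: "ball x (r/2) \<subseteq> ball z r" if "x \<in> S" for x
    using that unfolding S_def by (metis field_sum_of_halves mem_ball subset_iff
        dist_triangle_half_l dist_commute)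
  have cauchy: "\<exists>K. \<forall>m\<ge>K. \<forall>n\<ge>K. \<forall>x\<in>S. \<forall>v. cmod (D m x v - D n x v) \<le> e * norm v"
    if "e > 0" for e
  proof -
    have "e * r / 8 > 0" using that r by simp
    then obtain K where K: "\<And>n y. n \<ge> K \<Longrightarrow> y \<in> ball z r \<Longrightarrow> dist (f n y) (g y) < e * r / 8"
      using r(3) unfolding uniform_limit_sequentially_iff by blast
    have "cmod (D m x v - D n x v) \<le> e * norm v" if "m \<ge> K" "n \<ge> K" "x \<in> S" for m n x v
    proof -
      have "cmod (D m x v + (-1) * D n x v) \<le> 2 * (e * r / 4) / (r/2) * norm v"
      proof (rule Cauchy_derivative_bound)
        show "cn_holomorphic_on (\<lambda>y. f m y + (-1) * f n y) U"
          by (intro cn_holomorphic_on_add cn_holomorphic_on_mult cn_holomorphic_on_const hol)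
        show "ball x (r/2) \<subseteq> U" using sub[OF that(3)] r by blast
        show "((\<lambda>y. f m y + (-1) * f n y) has_derivative (\<lambda>v. D m x v + (-1) * D n x v)) (at x)"
          using D(1)[OF SU[OF that(3)]]
          by (intro has_derivative_add has_derivative_mult_right)
        fix y assume "y \<in> ball x (r/2)"
        then have y: "y \<in> ball z r" using sub[OF that(3)] by blast
        have "dist (f m y) (f n y) \<le> e * r / 8 + e * r / 8"
          using K[OF that(1) y] K[OF that(2) y] by (smt (verit) dist_commute dist_triangle)
        then show "cmod (f m y + (-1) * f n y) \<le> e * r / 4"
          by (simp add: dist_norm)
      qed (use r in simp)
      also have "\<dots> = e * norm v" using r(1) by simp
      finally show ?thesis by simp
    qed
    then show ?thesis by blast
  qed
  define G where "G x v = lim (\<lambda>n. D n x v)" for x v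
  have G: "(\<lambda>n. D n x v) \<longlonglongrightarrow> G x v" if x: "x \<in> S" for x v
  proof -
    have "Cauchy (\<lambda>n. D n x v)"
    proof (rule CauchyI)
      fix e :: real assume e: "e > 0"
      define e' where "e' = e / (2 * (norm v + 1))"
      have "e' > 0" using e by (simp add: e'_def add_nonneg_pos)
      from cauchy[OF this] obtain K where
        K: "\<And>m n. m \<ge> K \<Longrightarrow> n \<ge> K \<Longrightarrow> cmod (D m x v - D n x v) \<le> e' * norm v"
        using x by metis
      have "e' * norm v \<le> e' * (norm v + 1)" using \<open>e' > 0\<close> by simp
      also have "\<dots> = e / 2" unfolding e'_def by (simp add: field_simps add_nonneg_eq_0_iff)
      finally have "e' * norm v < e" using e by simp
      then show "\<exists>M. \<forall>m\<ge>M. \<forall>n\<ge>M. cmod (D m x v - D n x v) < e"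
        using K by (meson le_less_trans)
    qed
    then show ?thesis
      unfolding G_def using Cauchy_convergent convergent_LIMSEQ_iff by blast
  qed
  have close: "\<forall>\<^sub>F n in sequentially. \<forall>x\<in>S. \<forall>v. norm (D n x v - G x v) \<le> e * norm v"
    if e: "e > 0" for e
  proof -
    obtain K where K: "\<And>m n x v. m \<ge> K \<Longrightarrow> n \<ge> K \<Longrightarrow> x \<in> S \<Longrightarrow>
        cmod (D m x v - D n x v) \<le> e * norm v"
      using cauchy[OF e] by blast
    have "norm (D n x v - G x v) \<le> e * norm v" if "n \<ge> K" "x \<in> S" for n x v
    proof (rule tendsto_upperbound)
      show "(\<lambda>m. norm (D n x v - D m x v)) \<longlonglongrightarrow> norm (D n x v - G x v)"
        by (intro tendsto_intros G that)
      show "\<forall>\<^sub>F m in sequentially. norm (D n x v - D m x v) \<le> e * norm v"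
        using K that unfolding eventually_sequentially by blast
    qed simp
    then show ?thesis unfolding eventually_sequentially by blast
  qed
  have zS: "z \<in> S" using r by (simp add: S_def)
  have pt: "(\<lambda>n. f n x) \<longlonglongrightarrow> g x" if "x \<in> S" for x
    using tendsto_uniform_limitI[OF r(3)] that r(1) by (auto simp: S_def)
  have "\<exists>g'. \<forall>x\<in>S. (\<lambda>n. f n x) \<longlonglongrightarrow> g' x \<and> (g' has_derivative G x) (at x within S)"
  proof (rule has_derivative_sequence)
    show "convex S" by (simp add: S_def)
    show "\<And>e. e > 0 \<Longrightarrow> \<forall>\<^sub>F n in sequentially. \<forall>x\<in>S. \<forall>v. norm (D n x v - G x v) \<le> e * norm v"
      by (fact close)
    show "(f n has_derivative D n x) (at x within S)" if "x \<in> S" for n x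
      using D(1)[OF SU[OF that]] by (rule has_derivative_at_withinI)
    show "z \<in> S" "(\<lambda>n. f n z) \<longlonglongrightarrow> g z" using zS pt[OF zS] .
  qed
  then obtain g' where g': "\<And>x. x \<in> S \<Longrightarrow> (\<lambda>n. f n x) \<longlonglongrightarrow> g' x"
    "\<And>x. x \<in> S \<Longrightarrow> (g' has_derivative G x) (at x within S)"
    by blast
  have "(g' has_derivative G z) (at z)"
    using g'(2)[OF zS] at_within_open[OF zS] by (simp add: S_def)
  then have "(g has_derivative G z) (at z)"
    by (rule has_derivative_transform_within_open[OF _ _ zS])
      (use LIMSEQ_unique[OF g'(1) pt] in \<open>auto simp: S_def\<close>)
  moreover have "G z (c *s v) = c * G z v" for c v
  proof (rule LIMSEQ_unique[OF G[OF zS]])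
    show "(\<lambda>n. D n z (c *s v)) \<longlonglongrightarrow> c * G z v"
      unfolding D(2)[OF z] by (intro tendsto_intros G zS)
  qed
  ultimately show "\<exists>D. (g has_derivative D) (at z) \<and> (\<forall>c v. D (c *s v) = c * D v)"
    by blast
qed

section \<open>Peaking functions on the unit ball of a norm\<close>

lemma is_cnormD:
  assumes "is_cnorm N"
  shows "0 \<le> N x" "N x = 0 \<longleftrightarrow> x = 0" "N (c *s x) = cmod c * N x" "N (x + y) \<le> N x + N y"
    "N (r *\<^sub>R x) = \<bar>r\<bar> * N x"
  using assms unfolding is_cnorm_def scaleR_eq_smult by auto

lemma continuous_on_is_cnorm:
  fixes N :: "complex ^ 'n \<Rightarrow> real"
  assumes "is_cnorm N"
  shows "continuous_on UNIV N"
  unfolding continuous_on_sequentially o_def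
proof safe
  fix u :: "nat \<Rightarrow> complex ^ 'n" and a assume "u \<longlonglongrightarrow> a"
  then have *: "(\<lambda>k. N (u k - a)) \<longlonglongrightarrow> 0"
    using is_cnorm_tendsto_iff[OF assms] by blast
  have neg: "N (- x) = N x" for x
    using is_cnormD(5)[OF assms, of "-1" x] by simp
  have "\<bar>N (u k) - N a\<bar> \<le> N (u k - a)" for k
    using is_cnormD(4)[OF assms, of "u k - a" a] is_cnormD(4)[OF assms, of "a - u k" "u k"]
      neg[of "u k - a"] by simp
  then have "(\<lambda>k. N (u k) - N a) \<longlonglongrightarrow> 0"
    by (intro Lim_null_comparison[OF _ *]) simp
  then show "(\<lambda>k. N (u k)) \<longlonglongrightarrow> N a"
    by (simp add: LIM_zero_iff)
qed

lemma norm_sphere_nonempty: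
  fixes N :: "complex ^ 'n \<Rightarrow> real"
  assumes N: "is_cnorm N"
  shows "norm_sphere N \<noteq> {}"
proof -
  define v where "v = (axis undefined 1 :: complex ^ 'n)"
  have "v \<noteq> 0" by (simp add: v_def axis_eq_0_iff)
  then have "N v > 0" using is_cnormD(1,2)[OF N, of v] by (simp add: less_le)
  then have "N ((1 / N v) *\<^sub>R v) = 1" by (simp add: is_cnormD(5)[OF N])
  then show ?thesis by (auto simp: norm_sphere_def)
qed

lemma open_norm_ball:
  assumes "is_cnorm N"
  shows "open (norm_ball N)"
  using open_Collect_less[OF continuous_on_is_cnorm[OF assms] continuous_on_const]
  by (simp add: norm_ball_def)

lemma convex_norm_ball:
  assumes "is_cnorm N"
  shows "convex (norm_ball N)"
  unfolding convex_def norm_ball_def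
proof clarsimp
  fix x y and u v :: real assume *: "N x < 1" "N y < 1" "0 \<le> u" "0 \<le> v" "u + v = 1"
  have "N (u *\<^sub>R x + v *\<^sub>R y) \<le> u * N x + v * N y"
    using is_cnormD(4)[OF assms, of "u *\<^sub>R x" "v *\<^sub>R y"] * by (simp add: is_cnormD(5)[OF assms])
  also have "\<dots> < 1" using * by (rule convex_bound_lt)
  finally show "N (u *\<^sub>R x + v *\<^sub>R y) < 1" .
qed

text \<open>
  A real hyperplane separating \<open>a\<close> from the open unit ball gives a real functional \<open>inner w\<close>; as
  usual, \<open>x \<mapsto> inner w x - \<i> * inner w (\<i> *s x)\<close> is the complex linear functional with this real
  part, and rotating \<open>x\<close> shows that its modulus obeys the same bound.
\<close>

lemma exists_supporting_functional:
  fixes a :: "complex ^ 'n"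
  assumes N: "is_cnorm N" and a: "N a = 1"
  obtains L where "complex_linear L" "\<And>x. cmod (L x) \<le> N x" "L a = 1"
proof -
  have "norm_ball N \<inter> {a} = {}" "0 \<in> norm_ball N"
    using a is_cnormD(2)[OF N, of 0] by (auto simp: norm_ball_def)
  then obtain w b where w: "w \<noteq> 0" "\<And>x. N x < 1 \<Longrightarrow> inner w x \<le> b" "inner w a \<ge> b"
    using separating_hyperplane_sets[OF convex_norm_ball[OF N] convex_singleton, of a]
    by (auto simp: norm_ball_def)
  have b: "b \<ge> 0"
    using w(2)[of 0] is_cnormD(2)[OF N, of 0] by simp
  have le: "inner w x \<le> b * N x" for x
  proof (cases "x = 0")
    case False
    then have pos: "N x > 0"
      using is_cnormD(1,2)[OF N, of x] by (simp add: less_le)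
    show ?thesis
    proof (rule field_le_mult_one_interval)
      fix s :: real assume s: "0 < s" "s < 1"
      have "inner w ((s / N x) *\<^sub>R x) \<le> b"
        using s pos by (intro w(2)) (simp add: is_cnormD(5)[OF N])
      then show "s * inner w x \<le> b * N x"
        using pos by (simp add: field_simps)
    qed
  qed (use b is_cnormD(1)[OF N] in simp)
  have "inner w w > 0" using w(1) by simp
  then have "b \<noteq> 0" using le[of w] by (metis mult_zero_left not_less)
  with b have b: "b > 0" by simp
  define L where "L x = Complex (inner w x) (- inner w (\<i> *s x)) / b" for x
  have lin: "complex_linear L"
    unfolding complex_linear_def
  proof (intro conjI allI)
    have add: "\<i> *s (x + y) = \<i> *s x + \<i> *s y" for x y :: "complex ^ 'n"
      by (simp add: vec_eq_iff algebra_simps)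
    have scale: "\<i> *s (r *\<^sub>R x) = r *\<^sub>R (\<i> *s x)" for x :: "complex ^ 'n" and r
      by (simp add: vec_eq_iff scaleR_eq_smult)
    show "linear L"
      by (intro linearI) (auto simp: L_def add scale inner_add_right complex_eq_iff add_divide_distrib diff_divide_distrib)
    fix c and v :: "complex ^ 'n"
    have c: "c *s v = Re c *\<^sub>R v + Im c *\<^sub>R (\<i> *s v)"
      unfolding vec_eq_iff vector_scaleR_component vector_smult_component vector_add_component
      by (auto simp: complex_eq_iff)
    have ic: "\<i> *s (c *s v) = Re c *\<^sub>R (\<i> *s v) - Im c *\<^sub>R v"
      unfolding vec_eq_iff vector_scaleR_component vector_smult_component vector_minus_component
      by (auto simp: complex_eq_iff)
    show "L (c *s v) = c * L v"
      unfolding L_def ic by (subst c) (simp add: complex_eq_iff inner_add_right inner_diff_right field_simps)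
  qed
  have bound: "cmod (L x) \<le> N x" for x
  proof (cases "L x = 0")
    case False
    define c where "c = cnj (L x) / cmod (L x)"
    have c: "cmod c = 1" using False by (simp add: c_def norm_divide)
    have "L (c *s x) = cmod (L x)"
      using lin False complex_norm_square[of "L x"]
      by (simp add: complex_linear_def c_def power2_eq_square field_simps)
    then have "cmod (L x) = inner w (c *s x) / b"
      unfolding L_def[of "c *s x"] by (simp add: complex_eq_iff)
    also have "\<dots> \<le> N (c *s x)" using le[of "c *s x"] b by (simp add: field_simps)
    finally show ?thesis using c is_cnormD(3)[OF N, of c x] by simp
  qed (simp add: is_cnormD(1)[OF N])
  have "Re (L a) \<ge> 1" using w(3) b by (simp add: L_def)
  then have Re: "Re (L a) = 1"
    using complex_Re_le_cmod[of "L a"] bound[of a] a by linarith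
  have "(cmod (L a))\<^sup>2 \<le> 1"
    using bound[of a] a by (simp add: power_le_one)
  then have "Im (L a) = 0" using Re by (simp add: cmod_power2)
  with Re have "L a = 1" by (simp add: complex_eq_iff)
  with lin bound show ?thesis using that by blast
qed

text \<open>
  For \<open>Im z = 0\<close> the value \<open>exp z\<close> lies on the segment from \<open>0\<close> to \<open>1\<close> and equality holds; turning
  it by the angle \<open>Im z\<close> moves it by at most \<open>\<bar>Im z\<bar>\<close>.
\<close>

lemma cmod_exp_add_one_minus_exp_le:
  assumes "Re z \<le> 0"
  shows "cmod (exp z) + cmod (1 - exp z) \<le> 1 + \<bar>Im z\<bar>"
proof -
  define A where "A = exp (Re z)"
  have A: "0 < A" "A \<le> 1" using assms by (auto simp: A_def)
  have ez: "exp z = of_real A * exp (\<i> * of_real (Im z))"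
    by (subst complex_eq[of z]) (simp add: exp_add A_def exp_of_real)
  have "1 - exp z = of_real (1 - A) + of_real A * (1 - exp (\<i> * of_real (Im z)))"
    by (simp add: ez algebra_simps)
  then have "cmod (1 - exp z) \<le> cmod (of_real (1 - A)) + cmod (of_real A * (1 - exp (\<i> * of_real (Im z))))"
    using norm_triangle_ineq by metis
  also have "\<dots> = (1 - A) + A * dist (exp (\<i> * of_real (Im z))) 1"
    using A unfolding norm_of_real norm_mult by (simp add: dist_norm norm_minus_commute)
  also have "dist (exp (\<i> * of_real (Im z))) 1 \<le> \<bar>Im z\<bar>"
    using dist_exp_i_1[of "Im z"] abs_sin_x_le_abs_x[of "Im z / 2"] by (simp add: dist_norm)
  then have "(1 - A) + A * dist (exp (\<i> * of_real (Im z))) 1 \<le> (1 - A) + 1 * \<bar>Im z\<bar>"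
    using A by (intro add_left_mono mult_mono) auto
  finally show ?thesis using A by (simp add: A_def)
qed

text \<open>
  The function is \<open>(1 + R (1 - w)) powr (- \<alpha>)\<close>.  Its base has real part greater than \<open>1\<close>, so a
  small exponent \<open>\<alpha>\<close> forces the values into a thin sector around the segment from \<open>0\<close> to \<open>1\<close>.
  However small \<open>\<alpha>\<close> is, a large \<open>R\<close> makes the function small away from \<open>w = 1\<close>, where it is \<open>1\<close>.
\<close>

lemma exists_peaking_function_half_plane:
  fixes \<epsilon> \<rho> :: real
  assumes \<epsilon>: "\<epsilon> > 0" and \<rho>: "\<rho> < 1"
  obtains \<psi> s where "\<psi> holomorphic_on {w. Re w < 1}"
    "\<And>w. Re w < 1 \<Longrightarrow> cmod (\<psi> w) + cmod (1 - \<psi> w) \<le> 1 + \<epsilon>"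
    "\<And>w. Re w \<le> \<rho> \<Longrightarrow> cmod (\<psi> w) \<le> \<epsilon>"
    "0 < s" "s < 1" "s < \<epsilon>" "cmod (1 - \<psi> (of_real (1 - s))) < \<epsilon>"
proof -
  \<comment> \<open>the argument of the base is below \<open>pi / 2 < 2\<close>, hence that of \<open>\<psi>\<close> is at most \<open>2 * \<alpha> = \<epsilon>\<close>\<close>
  define \<alpha> where "\<alpha> = \<epsilon> / 2"
  \<comment> \<open>chosen so that the base has modulus at least \<open>\<epsilon> powr (- 1 / \<alpha>)\<close> when \<open>Re w \<le> \<rho>\<close>\<close>
  define R where "R = exp (- ln \<epsilon> / \<alpha>) / (1 - \<rho>)"
  define q where "q w = 1 + of_real R * (1 - w)" for w :: complex
  define \<psi> where "\<psi> w = exp (- of_real \<alpha> * Ln (q w))" for w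
  have \<alpha>: "\<alpha> > 0" using \<epsilon> by (simp add: \<alpha>_def)
  have R: "R > 0" using \<rho> by (simp add: R_def)
  have Req: "Re (q w) = 1 + R * (1 - Re w)" for w by (simp add: q_def)
  have q1: "Re (q w) > 1" if "Re w < 1" for w using that R by (simp add: Req)
  have ReLn: "Re (Ln (q w)) = ln (cmod (q w))" "q w \<noteq> 0" if "Re w < 1" for w
    using q1[OF that] by (auto intro!: Re_Ln)
  have cm: "cmod (\<psi> w) = exp (- \<alpha> * ln (cmod (q w)))" if "Re w < 1" for w
    using ReLn[OF that] by (simp add: \<psi>_def norm_exp_eq_Re)
  have 1: "\<psi> holomorphic_on {w. Re w < 1}"
    unfolding \<psi>_def q_def
  proof (intro holomorphic_intros)
    fix w assume "w \<in> {w. Re w < 1}"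
    then show "1 + of_real R * (1 - w) \<notin> \<real>\<^sub>\<le>\<^sub>0"
      using q1[of w] by (auto simp: complex_nonpos_Reals_iff q_def)
  qed
  have 2: "cmod (\<psi> w) + cmod (1 - \<psi> w) \<le> 1 + \<epsilon>" if w: "Re w < 1" for w
  proof -
    have "cmod (q w) \<ge> 1" using q1[OF w] complex_Re_le_cmod[of "q w"] by linarith
    then have "Re (- of_real \<alpha> * Ln (q w)) \<le> 0" using ReLn[OF w] \<alpha> by simp
    from cmod_exp_add_one_minus_exp_le[OF this]
    have "cmod (\<psi> w) + cmod (1 - \<psi> w) \<le> 1 + \<alpha> * \<bar>Im (Ln (q w))\<bar>"
      using \<alpha> by (simp add: \<psi>_def abs_mult)
    also have "\<bar>Im (Ln (q w))\<bar> \<le> 2"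
      using Re_Ln_pos_lt[OF ReLn(2)[OF w]] q1[OF w] pi_less_4 by simp
    then have "1 + \<alpha> * \<bar>Im (Ln (q w))\<bar> \<le> 1 + \<alpha> * 2" using \<alpha> by simp
    finally show ?thesis by (simp add: \<alpha>_def)
  qed
  have 3: "cmod (\<psi> w) \<le> \<epsilon>" if "Re w \<le> \<rho>" for w
  proof -
    have w: "Re w < 1" using that \<rho> by simp
    have "exp (- ln \<epsilon> / \<alpha>) = R * (1 - \<rho>)" using \<rho> by (simp add: R_def)
    also have "\<dots> \<le> R * (1 - Re w)" using that R by simp
    also have "\<dots> \<le> Re (q w)" by (simp add: Req)
    also have "\<dots> \<le> cmod (q w)" by (rule complex_Re_le_cmod)
    finally have *: "exp (- ln \<epsilon> / \<alpha>) \<le> cmod (q w)" .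
    then have "- ln \<epsilon> / \<alpha> \<le> ln (cmod (q w))"
      using ReLn(2)[OF w] by (simp add: ln_ge_iff)
    then have "- \<alpha> * ln (cmod (q w)) \<le> ln \<epsilon>" using \<alpha> by (simp add: field_simps)
    then have "exp (- \<alpha> * ln (cmod (q w))) \<le> \<epsilon>"
      using \<epsilon> by (metis exp_le_cancel_iff exp_ln)
    then show ?thesis by (simp add: cm[OF w])
  qed
  have "isCont \<psi> 1"
    unfolding \<psi>_def q_def by (intro continuous_intros) auto
  moreover have "\<psi> 1 = 1" by (simp add: \<psi>_def q_def)
  ultimately obtain d where d: "d > 0" "\<And>w. dist w 1 < d \<Longrightarrow> dist (\<psi> w) 1 < \<epsilon>"
    using \<epsilon> unfolding continuous_at_eps_delta by metis
  define s where "s = min d (min \<epsilon> 1) / 2"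
  have s: "0 < s" "s < 1" "s < \<epsilon>" "s < d" using \<epsilon> d(1) by (auto simp: s_def)
  have "dist (\<psi> (of_real (1 - s))) 1 < \<epsilon>"
    using s by (intro d(2)) (simp add: dist_norm)
  then have "cmod (1 - \<psi> (of_real (1 - s))) < \<epsilon>"
    by (simp add: dist_norm norm_minus_commute)
  with 1 2 3 s show ?thesis using that by blast
qed

lemma exists_peaking_function:
  fixes a :: "complex ^ 'n" and \<epsilon> \<rho> :: real
  assumes N: "is_cnorm N" and a: "N a = 1" and \<epsilon>: "\<epsilon> > 0" and \<rho>: "\<rho> < 1"
  obtains h x where "cn_holomorphic_on h (norm_ball N)"
    "\<And>y. N y < 1 \<Longrightarrow> cmod (h y) + cmod (1 - h y) \<le> 1 + \<epsilon>"
    "\<And>y. N y \<le> \<rho> \<Longrightarrow> cmod (h y) \<le> \<epsilon>"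
    "N x < 1" "N (x - a) < \<epsilon>" "cmod (1 - h x) < \<epsilon>"
proof -
  obtain L where L: "complex_linear L" "\<And>x. cmod (L x) \<le> N x" "L a = 1"
    using exists_supporting_functional[OF N a] by blast
  obtain \<psi> s where \<psi>: "\<psi> holomorphic_on {w. Re w < 1}"
    "\<And>w. Re w < 1 \<Longrightarrow> cmod (\<psi> w) + cmod (1 - \<psi> w) \<le> 1 + \<epsilon>"
    "\<And>w. Re w \<le> \<rho> \<Longrightarrow> cmod (\<psi> w) \<le> \<epsilon>"
    and s: "0 < s" "s < 1" "s < \<epsilon>" "cmod (1 - \<psi> (of_real (1 - s))) < \<epsilon>"
    using exists_peaking_function_half_plane[OF \<epsilon> \<rho>] by blast
  have Re: "Re (L y) \<le> N y" for y
    using L(2)[of y] complex_Re_le_cmod[of "L y"] by linarith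
  have La: "L ((1 - s) *\<^sub>R a) = of_real (1 - s)"
    using L(1,3) unfolding complex_linear_def scaleR_eq_smult by (metis mult.right_neutral)
  show ?thesis
  proof (rule that)
    show "cn_holomorphic_on (\<lambda>y. \<psi> (L y)) (norm_ball N)"
    proof (rule cn_holomorphic_on_compose[OF complex_linear_imp_cn_holomorphic_on[OF L(1)] \<psi>(1)])
      show "open {w. Re w < 1}" by (rule open_halfspace_Re_lt)
      show "L ` norm_ball N \<subseteq> {w. Re w < 1}"
        using Re by (force simp: norm_ball_def intro: le_less_trans)
    qed
    show "N ((1 - s) *\<^sub>R a) < 1" using s a by (simp add: is_cnormD(5)[OF N])
    have "(1 - s) *\<^sub>R a - a = (- s) *\<^sub>R a" by (simp add: scaleR_diff_left)
    then have "N ((1 - s) *\<^sub>R a - a) = s" using s a by (simp only: is_cnormD(5)[OF N])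
    then show "N ((1 - s) *\<^sub>R a - a) < \<epsilon>" using s by simp
    show "cmod (1 - \<psi> (L ((1 - s) *\<^sub>R a))) < \<epsilon>" using s(4) by (simp add: La)
    show "cmod (\<psi> (L y)) + cmod (1 - \<psi> (L y)) \<le> 1 + \<epsilon>" if "N y < 1" for y
      using Re[of y] that by (intro \<psi>(2)) simp
    show "cmod (\<psi> (L y)) \<le> \<epsilon>" if "N y \<le> \<rho>" for y
      using Re[of y] that by (intro \<psi>(3)) simp
  qed
qed

section \<open>Asymptotic interpolation near the sphere\<close>

text \<open>
  The quantitative Cauchy criterion behind the recursive construction: the tail of the geometric
  series bounds the distance to the limit.
\<close>

lemma geometric_steps_converge:
  fixes u :: "nat \<Rightarrow> complex"
  assumes step: "\<And>j. j \<ge> k \<Longrightarrow> cmod (u (Suc j) - u j) \<le> c / 2 ^ j"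
  obtains l where "u \<longlonglongrightarrow> l" "\<And>j. j \<ge> k \<Longrightarrow> cmod (l - u j) \<le> 2 * c / 2 ^ j"
proof -
  have c: "c \<ge> 0"
    using order_trans[OF norm_ge_zero step[of k]] by (simp add: pos_le_divide_eq)
  have bound: "cmod (u (j + m) - u j) \<le> 2 * c / 2 ^ j" if "j \<ge> k" for j m
  proof -
    have "cmod (u (j + m) - u j) \<le> 2 * c / 2 ^ j - 2 * c / 2 ^ (j + m)"
    proof (induction m)
      case (Suc m)
      have "cmod (u (j + Suc m) - u j) \<le> cmod (u (Suc (j + m)) - u (j + m)) + cmod (u (j + m) - u j)"
        using norm_triangle_ineq[of "u (Suc (j + m)) - u (j + m)" "u (j + m) - u j"] by simp
      also have "\<dots> \<le> c / 2 ^ (j + m) + (2 * c / 2 ^ j - 2 * c / 2 ^ (j + m))"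
        using Suc step[of "j + m"] that by simp
      also have "\<dots> = 2 * c / 2 ^ j - 2 * c / 2 ^ (j + Suc m)" by simp
      finally show ?case .
    qed simp
    also have "\<dots> \<le> 2 * c / 2 ^ j" using c by simp
    finally show ?thesis .
  qed
  have "(\<lambda>j. 2 * c * (1/2) ^ j) \<longlonglongrightarrow> 2 * c * 0"
    by (intro tendsto_intros) simp
  then have null: "(\<lambda>j. 2 * c / 2 ^ j) \<longlonglongrightarrow> 0"
    by (simp add: power_one_over)
  have "Cauchy u"
    unfolding Cauchy_altdef2
  proof (intro allI impI)
    fix e :: real assume "e > 0"
    then obtain J where J: "\<And>j. j \<ge> J \<Longrightarrow> 2 * c / 2 ^ j < e"
      using order_tendstoD(2)[OF null] unfolding eventually_sequentially by blast
    have "dist (u n) (u (max J k)) < e" if "n \<ge> max J k" for n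
      using bound[of "max J k" "n - max J k"] J[of "max J k"] that by (simp add: dist_norm)
    then show "\<exists>M. \<forall>n\<ge>M. dist (u n) (u M) < e" by blast
  qed
  then obtain l where l: "u \<longlonglongrightarrow> l" using Cauchy_convergent convergent_def by blast
  have "cmod (l - u j) \<le> 2 * c / 2 ^ j" if "j \<ge> k" for j
  proof (rule tendsto_upperbound)
    show "(\<lambda>m. cmod (u (m + j) - u j)) \<longlonglongrightarrow> cmod (l - u j)"
      by (intro tendsto_intros LIMSEQ_ignore_initial_segment l)
    show "\<forall>\<^sub>F m in sequentially. cmod (u (m + j) - u j) \<le> 2 * c / 2 ^ j"
      using bound[OF that] by (simp add: add.commute)
  qed simp
  with l that show ?thesis by blast
qed

text \<open>
  The functions \<open>F d k\<close> arise by the corrections \<open>f \<mapsto> (1 - h k) f + d k * h k\<close>.  Only the peaking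
  functions \<open>h k\<close> and the points \<open>x k\<close> have to be chosen, and this is done independently of \<open>d\<close>; so
  the same points serve all sequences \<open>d\<close>.  The balls \<open>{y. N y \<le> r k}\<close> exhaust the unit ball, the one of
  index \<open>Suc k\<close> contains \<open>x k\<close>, and \<open>h j\<close> has modulus at most \<open>\<epsilon> j = 1 / 2 ^ j\<close> on it for all
  \<open>j > k\<close>; therefore the corrections converge locally uniformly, and the later ones disturb the
  value at \<open>x k\<close> by \<open>O(\<epsilon> k)\<close> only.
\<close>

lemma asymptotic_interpolation:
  fixes a :: "nat \<Rightarrow> complex ^ 'n"
  assumes N: "is_cnorm N" and a: "\<And>k. N (a k) = 1"
  obtains x and T :: "(nat \<Rightarrow> complex) \<Rightarrow> complex ^ 'n \<Rightarrow> complex" where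
    "\<And>k. x k \<in> norm_ball N" "(\<lambda>k. x k - a k) \<longlonglongrightarrow> 0"
    "\<And>d. \<forall>k. cmod (d k) \<le> 1 \<Longrightarrow> T d \<in> Hinf (norm_ball N)"
    "\<And>d. \<forall>k. cmod (d k) \<le> 1 \<Longrightarrow> (\<lambda>k. T d (x k) - d k) \<longlonglongrightarrow> 0"
proof -
  define \<epsilon> :: "nat \<Rightarrow> real" where "\<epsilon> k = 1 / 2 ^ k" for k
  have \<epsilon>: "\<epsilon> k > 0" for k by (simp add: \<epsilon>_def)
  have \<epsilon>0: "\<epsilon> \<longlonglongrightarrow> 0"
    unfolding \<epsilon>_def using LIMSEQ_power_zero[of "1/2 :: real"] by (simp add: power_one_over)
  let ?P = "\<lambda>k \<rho> h x. cn_holomorphic_on h (norm_ball N) \<and>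
    (\<forall>y. N y < 1 \<longrightarrow> cmod (h y) + cmod (1 - h y) \<le> 1 + \<epsilon> k) \<and>
    (\<forall>y. N y \<le> \<rho> \<longrightarrow> cmod (h y) \<le> \<epsilon> k) \<and>
    N x < 1 \<and> N (x - a k) < \<epsilon> k \<and> cmod (1 - h x) < \<epsilon> k"
  have "\<exists>h x. ?P k \<rho> h x" if "\<rho> < 1" for k \<rho>
    using exists_peaking_function[OF N a[of k] \<epsilon>[of k] that] by metis
  then have "\<forall>k \<rho>. \<exists>h x. \<rho> < 1 \<longrightarrow> ?P k \<rho> h x" by blast
  then obtain H X where "\<forall>k \<rho>. \<rho> < 1 \<longrightarrow> ?P k \<rho> (H k \<rho>) (X k \<rho>)"
    unfolding choice_iff by blast
  then have HX: "\<And>k \<rho>. \<rho> < 1 \<Longrightarrow> cn_holomorphic_on (H k \<rho>) (norm_ball N)"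
    "\<And>k \<rho> y. \<rho> < 1 \<Longrightarrow> N y < 1 \<Longrightarrow> cmod (H k \<rho> y) + cmod (1 - H k \<rho> y) \<le> 1 + \<epsilon> k"
    "\<And>k \<rho> y. \<rho> < 1 \<Longrightarrow> N y \<le> \<rho> \<Longrightarrow> cmod (H k \<rho> y) \<le> \<epsilon> k"
    "\<And>k \<rho>. \<rho> < 1 \<Longrightarrow> N (X k \<rho>) < 1"
    "\<And>k \<rho>. \<rho> < 1 \<Longrightarrow> N (X k \<rho> - a k) < \<epsilon> k"
    "\<And>k \<rho>. \<rho> < 1 \<Longrightarrow> cmod (1 - H k \<rho> (X k \<rho>)) < \<epsilon> k"
    by blast+
  \<comment> \<open>radii increasing to \<open>1\<close>, the one for step \<open>Suc k\<close> large enough to enclose \<open>x k\<close>\<close>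
  define r where "r = rec_nat 0 (\<lambda>k \<rho>. max (max \<rho> (N (X k \<rho>))) (1 - \<epsilon> k))"
  define h where "h k = H k (r k)" for k
  define x where "x k = X k (r k)" for k
  have r_Suc: "r (Suc k) = max (max (r k) (N (x k))) (1 - \<epsilon> k)" for k
    by (simp add: r_def x_def)
  have r1: "r k < 1" for k
  proof (induction k)
    case (Suc k)
    then show ?case using HX(4) \<epsilon>[of k] by (simp add: r_Suc x_def)
  qed (simp add: r_def)
  have r_mono: "r j \<le> r k" if "j \<le> k" for j k
    by (rule lift_Suc_mono_le[OF _ that]) (simp add: r_Suc)
  have h_hol: "cn_holomorphic_on (h k) (norm_ball N)" for k
    unfolding h_def by (rule HX(1)[OF r1])
  have h_bound: "cmod (h k y) + cmod (1 - h k y) \<le> 1 + \<epsilon> k" if "N y < 1" for k y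
    unfolding h_def by (rule HX(2)[OF r1 that])
  have h_small: "cmod (h k y) \<le> \<epsilon> k" if "N y \<le> r j" "j \<le> k" for j k y
    unfolding h_def using r_mono[OF that(2)] that(1) by (intro HX(3)[OF r1]) simp
  have x1: "N (x k) < 1" and xa: "N (x k - a k) < \<epsilon> k" and hx: "cmod (1 - h k (x k)) < \<epsilon> k" for k
    unfolding h_def x_def using HX(4-6)[OF r1] by auto
  have x_le: "N (x k) \<le> r (Suc k)" for k by (simp add: r_Suc)
  define F where "F d = rec_nat (\<lambda>y. 0) (\<lambda>k f y. (1 - h k y) * f y + d k * h k y)" for d
  have F0: "F d 0 y = 0" and F_Suc: "F d (Suc k) y = (1 - h k y) * F d k y + d k * h k y" for d k y
    by (simp_all add: F_def)
  \<comment> \<open>a bound for the product of all factors \<open>1 + \<epsilon> k\<close>, as the \<open>\<epsilon> k\<close> add up to \<open>2\<close>\<close>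
  define M where "M = exp (2 :: real)"
  have M: "M \<ge> 1" by (simp add: M_def)
  have F_hol: "cn_holomorphic_on (F d k) (norm_ball N)" for d k
  proof (induction k)
    case 0
    have "F d 0 = (\<lambda>y. 0)" by (simp add: F_def)
    then show ?case using cn_holomorphic_on_const by metis
  next
    case (Suc k)
    have *: "F d (Suc k) = (\<lambda>y. (1 + (-1) * h k y) * F d k y + d k * h k y)"
      by (simp add: fun_eq_iff F_Suc)
    show ?case
      unfolding *
      by (intro cn_holomorphic_on_add cn_holomorphic_on_mult cn_holomorphic_on_const h_hol Suc)
  qed
  have F_bound: "cmod (F d k y) \<le> M" if d: "\<forall>k. cmod (d k) \<le> 1" and y: "N y < 1" for d k y
  proof -
    \<comment> \<open>\<open>2 - 2 * \<epsilon> k\<close> is the sum of \<open>\<epsilon> j\<close> over \<open>j < k\<close>\<close>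
    have "cmod (F d k y) \<le> exp (2 - 2 * \<epsilon> k)"
    proof (induction k)
      case (Suc k)
      define E where "E = exp (2 - 2 * \<epsilon> k)"
      have "\<epsilon> k \<le> 1" by (simp add: \<epsilon>_def)
      then have E: "E \<ge> 1" by (simp add: E_def)
      have dk: "cmod (d k) \<le> E" using spec[OF d, of k] E by linarith
      have "cmod (F d (Suc k) y) \<le> cmod (1 - h k y) * cmod (F d k y) + cmod (d k) * cmod (h k y)"
        unfolding F_Suc by (metis norm_mult norm_triangle_ineq)
      also have "\<dots> \<le> cmod (1 - h k y) * E + E * cmod (h k y)"
        using Suc dk by (intro add_mono mult_left_mono mult_right_mono) (simp_all add: E_def)
      also have "\<dots> = (cmod (h k y) + cmod (1 - h k y)) * E" by (simp add: algebra_simps)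
      also have "\<dots> \<le> (1 + \<epsilon> k) * E"
        using h_bound[OF y, of k] E by (intro mult_right_mono) auto
      also have "\<dots> \<le> exp (\<epsilon> k) * E"
        using E by (intro mult_right_mono exp_ge_add_one_self) simp
      also have "\<dots> = exp (2 - 2 * \<epsilon> (Suc k))"
        by (simp add: E_def \<epsilon>_def flip: exp_add)
      finally show ?case .
    qed (simp add: F0)
    also have "\<dots> \<le> M" using \<epsilon>[of k] by (simp add: M_def)
    finally show ?thesis .
  qed
  have diff: "F d (Suc k) y - F d k y = h k y * (d k - F d k y)"
    and diff': "F d (Suc k) y - d k = (1 - h k y) * (F d k y - d k)" for d k y
    by (simp_all add: F_Suc algebra_simps)
  have dF: "cmod (d k - F d k y) \<le> 1 + M" if "\<forall>k. cmod (d k) \<le> 1" "N y < 1" for d k y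
    using norm_triangle_ineq4[of "d k" "F d k y"] spec[OF that(1), of k] F_bound[OF that, of k] by linarith
  have step: "cmod (F d (Suc k) y - F d k y) \<le> (1 + M) / 2 ^ k"
    if d: "\<forall>k. cmod (d k) \<le> 1" and y: "N y \<le> r j" and jk: "j \<le> k" for d j k y
  proof -
    have "N y < 1" using y r1[of j] by simp
    have "cmod (F d (Suc k) y - F d k y) \<le> \<epsilon> k * (1 + M)"
      unfolding diff norm_mult using dF[OF d \<open>N y < 1\<close>] h_small[OF y jk] \<epsilon>[of k]
      by (intro mult_mono) auto
    then show ?thesis by (simp add: \<epsilon>_def)
  qed
  define f where "f d y = lim (\<lambda>k. F d k y)" for d y
  have f: "(\<lambda>k. F d k y) \<longlonglongrightarrow> f d y" "\<And>k. k \<ge> j \<Longrightarrow> cmod (f d y - F d k y) \<le> 2 * (1 + M) / 2 ^ k"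
    if d: "\<forall>k. cmod (d k) \<le> 1" and y: "N y \<le> r j" for d y j
  proof -
    obtain l where l: "(\<lambda>k. F d k y) \<longlonglongrightarrow> l" "\<And>k. k \<ge> j \<Longrightarrow> cmod (l - F d k y) \<le> 2 * (1 + M) / 2 ^ k"
      using geometric_steps_converge[of j "\<lambda>k. F d k y" "1 + M"] step[OF d y] by blast
    have "f d y = l" unfolding f_def using l(1) by (rule limI)
    with l show "(\<lambda>k. F d k y) \<longlonglongrightarrow> f d y"
      "\<And>k. k \<ge> j \<Longrightarrow> cmod (f d y - F d k y) \<le> 2 * (1 + M) / 2 ^ k" by auto
  qed
  have exhaust: "\<exists>j. N y < r j" if "N y < 1" for y
  proof -
    have "\<forall>\<^sub>F k in sequentially. \<epsilon> k < 1 - N y"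
      using order_tendstoD(2)[OF \<epsilon>0] that by simp
    then obtain k where "\<epsilon> k < 1 - N y" unfolding eventually_sequentially by blast
    then have "N y < r (Suc k)" by (simp add: r_Suc)
    then show ?thesis by blast
  qed
  have null: "(\<lambda>k. 2 * (1 + M) / 2 ^ k) \<longlonglongrightarrow> 0"
    using tendsto_mult_right_zero[OF \<epsilon>0, of "2 * (1 + M)"] by (simp add: \<epsilon>_def)
  have f_hol: "cn_holomorphic_on (f d) (norm_ball N)" if d: "\<forall>k. cmod (d k) \<le> 1" for d
  proof (rule cn_holomorphic_on_locally_uniform_limit)
    show "cn_holomorphic_on (F d k) (norm_ball N)" for k by (rule F_hol)
    fix z assume "z \<in> norm_ball N"
    then obtain j where j: "N z < r j" using exhaust by (auto simp: norm_ball_def)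
    have "open {y. N y < r j}"
      using open_Collect_less[OF continuous_on_is_cnorm[OF N] continuous_on_const] by simp
    then obtain e where e: "e > 0" "ball z e \<subseteq> {y. N y < r j}"
      using j unfolding open_contains_ball by blast
    have "uniform_limit (ball z e) (F d) (f d) sequentially"
    proof (rule uniform_limitI)
      fix c :: real assume "c > 0"
      have "\<forall>\<^sub>F k in sequentially. 2 * (1 + M) / 2 ^ k < c \<and> k \<ge> j"
        using order_tendstoD(2)[OF null \<open>c > 0\<close>] eventually_ge_at_top by (rule eventually_conj)
      then show "\<forall>\<^sub>F k in sequentially. \<forall>y\<in>ball z e. dist (F d k y) (f d y) < c"
      proof (rule eventually_mono, intro ballI)
        fix k y assume k: "2 * (1 + M) / 2 ^ k < c \<and> k \<ge> j" and "y \<in> ball z e"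
        then have "N y \<le> r j" using e(2) by auto
        from f(2)[OF d this, of k] k show "dist (F d k y) (f d y) < c"
          by (simp add: dist_norm norm_minus_commute)
      qed
    qed
    moreover have "ball z e \<subseteq> norm_ball N"
      using e(2) r1[of j] by (auto simp: norm_ball_def)
    ultimately show "\<exists>e>0. ball z e \<subseteq> norm_ball N \<and> uniform_limit (ball z e) (F d) (f d) sequentially"
      using e(1) by blast
  qed
  have f_bound: "cmod (f d y) \<le> M" if d: "\<forall>k. cmod (d k) \<le> 1" and y: "N y < 1" for d y
  proof -
    obtain j where "N y \<le> r j" using exhaust[OF y] less_imp_le by blast
    from tendsto_norm[OF f(1)[OF d this]] show ?thesis
      by (rule tendsto_upperbound) (simp_all add: F_bound[OF d y])
  qed
  define T where "T d = restrict (f d) (norm_ball N)" for d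
  show ?thesis
  proof (rule that)
    show "x k \<in> norm_ball N" for k by (simp add: norm_ball_def x1)
    have "(\<lambda>k. N (x k - a k)) \<longlonglongrightarrow> 0"
      by (rule tendsto_sandwich[OF _ _ tendsto_const \<epsilon>0])
        (intro always_eventually allI is_cnormD(1)[OF N] less_imp_le[OF xa])+
    then show "(\<lambda>k. x k - a k) \<longlonglongrightarrow> 0"
      using is_cnorm_tendsto_iff[OF N, of "\<lambda>k. x k - a k" 0] by simp
  next
    fix d :: "nat \<Rightarrow> complex" assume d: "\<forall>k. cmod (d k) \<le> 1"
    have "cn_holomorphic_on (T d) (norm_ball N)"
      by (rule cn_holomorphic_on_cong_open[OF f_hol[OF d] open_norm_ball[OF N]]) (simp add: T_def)
    moreover have "bounded (T d ` norm_ball N)"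
      unfolding bounded_iff using f_bound[OF d]
      by (intro exI[of _ M]) (auto simp: T_def norm_ball_def)
    ultimately show "T d \<in> Hinf (norm_ball N)" by (simp add: Hinf_def T_def)
    have "cmod (T d (x k) - d k) \<le> 2 * (1 + M) / 2 ^ k" for k
    proof -
      have "cmod (f d (x k) - F d (Suc k) (x k)) \<le> 2 * (1 + M) / 2 ^ Suc k"
        by (rule f(2)[OF d x_le]) simp
      moreover have "cmod (F d (Suc k) (x k) - d k) \<le> \<epsilon> k * (1 + M)"
        unfolding diff' norm_mult using dF[OF d x1, of k] hx[of k] \<epsilon>[of k]
        by (intro mult_mono) (auto simp: norm_minus_commute)
      ultimately have "cmod (f d (x k) - d k) \<le> 2 * (1 + M) / 2 ^ Suc k + \<epsilon> k * (1 + M)"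
        using norm_triangle_ineq[of "f d (x k) - F d (Suc k) (x k)" "F d (Suc k) (x k) - d k"] by simp
      also have "\<dots> = 2 * (1 + M) / 2 ^ k" by (simp add: \<epsilon>_def field_simps)
      finally show ?thesis using x1[of k] by (simp add: T_def norm_ball_def)
    qed
    then show "(\<lambda>k. T d (x k) - d k) \<longlonglongrightarrow> 0"
      by (intro Lim_null_comparison[OF _ null]) simp
  qed
qed

section \<open>A family dense in a product of continuum many discs\<close>

lemma dense_sequence:
  fixes S :: "'a :: {metric_space, second_countable_topology} set"
  assumes "S \<noteq> {}"
  obtains s :: "nat \<Rightarrow> 'a" where "\<And>i. s i \<in> S" "\<And>z e. z \<in> S \<Longrightarrow> e > 0 \<Longrightarrow> \<exists>i. dist (s i) z < e"
proof -
  obtain T where T: "countable T" "T \<subseteq> S" "S \<subseteq> closure T" by (rule separable)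
  have "T \<noteq> {}" using assms T(3) by auto
  show ?thesis
  proof (rule that)
    show "from_nat_into T i \<in> S" for i
      using from_nat_into[OF \<open>T \<noteq> {}\<close>] T(2) by blast
    fix z and e :: real assume "z \<in> S" "e > 0"
    then obtain t where "t \<in> T" "dist t z < e"
      using T(3) closure_approachable[of z T] by blast
    then show "\<exists>i. dist (from_nat_into T i) z < e"
      using from_nat_into_surj[OF T(1)] by metis
  qed
qed

text \<open>
  Cutting the line into intervals of length \<open>1 / m\<close> puts finitely many reals into different intervals
  as soon as \<open>1 / m\<close> is below their mutual distances.
\<close>

lemma exists_separating_floor:
  fixes F :: "real set"
  assumes "finite F"
  obtains m :: nat where "inj_on (\<lambda>\<tau>. \<lfloor>real m * \<tau>\<rfloor>) F"
proof -
  have "\<forall>\<^sub>F m in sequentially. \<lfloor>real m * \<tau>\<rfloor> \<noteq> \<lfloor>real m * \<sigma>\<rfloor>" if ne: "\<tau> \<noteq> \<sigma>" for \<tau> \<sigma> :: real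
  proof -
    obtain M :: nat where M: "real M * \<bar>\<tau> - \<sigma>\<bar> > 1"
      using ne ex_less_of_nat_mult[of "\<bar>\<tau> - \<sigma>\<bar>" 1] by auto
    have "\<lfloor>real m * \<tau>\<rfloor> \<noteq> \<lfloor>real m * \<sigma>\<rfloor>" if "m \<ge> M" for m
    proof
      assume "\<lfloor>real m * \<tau>\<rfloor> = \<lfloor>real m * \<sigma>\<rfloor>"
      then have "\<bar>real m * \<tau> - real m * \<sigma>\<bar> < 1" by linarith
      then have "real m * \<bar>\<tau> - \<sigma>\<bar> < 1" by (simp add: abs_mult flip: right_diff_distrib)
      moreover have "real M * \<bar>\<tau> - \<sigma>\<bar> \<le> real m * \<bar>\<tau> - \<sigma>\<bar>"
        using that by (intro mult_right_mono) auto
      ultimately show False using M by simp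
    qed
    then show ?thesis unfolding eventually_sequentially by blast
  qed
  then have "\<forall>\<^sub>F m in sequentially. \<forall>\<tau>\<in>F. \<forall>\<sigma>\<in>F. \<tau> \<noteq> \<sigma> \<longrightarrow> \<lfloor>real m * \<tau>\<rfloor> \<noteq> \<lfloor>real m * \<sigma>\<rfloor>"
    using assms by (intro eventually_ball_finite ballI) auto
  then obtain m :: nat where "inj_on (\<lambda>\<tau>. \<lfloor>real m * \<tau>\<rfloor>) F"
    unfolding eventually_sequentially inj_on_def by blast
  then show ?thesis by (rule that)
qed

text \<open>
  The product of continuum many discs is separable (Hewitt, Marczewski, Pondiczery): step functions on
  the real line that take values in a countable dense subset of the disc on finitely many intervals of
  length \<open>1 / m\<close>, and the value \<open>0\<close> elsewhere, are countable in number and come close to any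
  prescribed values at finitely many places.  They are enumerated together with a dense sequence of \<open>S\<close>
  so that each combination occurs infinitely often.
\<close>

lemma dense_family:
  fixes S :: "'a :: {metric_space, second_countable_topology} set"
  assumes "S \<noteq> {}"
  obtains s :: "nat \<Rightarrow> 'a" and d :: "nat \<Rightarrow> real \<Rightarrow> complex" where
    "\<And>k. s k \<in> S" "\<And>k \<tau>. cmod (d k \<tau>) \<le> 1"
    "\<And>z F c e K. z \<in> S \<Longrightarrow> finite F \<Longrightarrow> \<forall>\<tau>\<in>F. cmod (c \<tau>) \<le> 1 \<Longrightarrow> e > 0 \<Longrightarrow>
       \<exists>k\<ge>K. dist (s k) z < e \<and> (\<forall>\<tau>\<in>F. dist (d k \<tau>) (c \<tau>) < e)"
proof -
  obtain t where t: "\<And>i. t i \<in> S" "\<And>z e. z \<in> S \<Longrightarrow> e > 0 \<Longrightarrow> \<exists>i::nat. dist (t i) z < e"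
    using dense_sequence[OF assms] by metis
  have "cball (0::complex) 1 \<noteq> {}" by simp
  then obtain v where v: "\<And>i. v i \<in> cball (0::complex) 1"
      "\<And>z e. z \<in> cball (0::complex) 1 \<Longrightarrow> e > 0 \<Longrightarrow> \<exists>i::nat. dist (v i) z < e"
    using dense_sequence by metis
  define E :: "nat \<Rightarrow> (int \<times> nat) list \<Rightarrow> real \<Rightarrow> complex" where
    "E m l \<tau> = (case map_of l \<lfloor>real m * \<tau>\<rfloor> of None \<Rightarrow> 0 | Some j \<Rightarrow> v j)" for m l \<tau>
  have E_le: "cmod (E m l \<tau>) \<le> 1" for m l \<tau>
    using v(1) by (auto simp: E_def split: option.splits)
  have E_dense: "\<exists>m l. \<forall>\<tau>\<in>F. dist (E m l \<tau>) (c \<tau>) < e"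
    if F: "finite F" and c: "\<forall>\<tau>\<in>F. cmod (c \<tau>) \<le> 1" and e: "e > 0" for F c e
  proof -
    obtain m :: nat where m: "inj_on (\<lambda>\<tau>. \<lfloor>real m * \<tau>\<rfloor>) F"
      using exists_separating_floor[OF F] .
    have "\<forall>\<tau>\<in>F. \<exists>i. dist (v i) (c \<tau>) < e" using v(2) c e by simp
    then obtain J where J: "\<And>\<tau>. \<tau> \<in> F \<Longrightarrow> dist (v (J \<tau>)) (c \<tau>) < e" by metis
    obtain xs where xs: "set xs = F" "distinct xs" using finite_distinct_list[OF F] by blast
    define l where "l = map (\<lambda>\<tau>. (\<lfloor>real m * \<tau>\<rfloor>, J \<tau>)) xs"
    have "distinct (map fst l)"
      using m xs by (simp add: l_def o_def distinct_map)
    then have "map_of l \<lfloor>real m * \<tau>\<rfloor> = Some (J \<tau>)" if "\<tau> \<in> F" for \<tau>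
      using that xs(1) by (intro map_of_is_SomeI) (auto simp: l_def)
    then have "\<forall>\<tau>\<in>F. dist (E m l \<tau>) (c \<tau>) < e" using J by (simp add: E_def)
    then show ?thesis by blast
  qed
  \<comment> \<open>the first component is a dummy; it makes every combination of the others recur beyond any \<open>K\<close>\<close>
  define D :: "nat \<Rightarrow> nat \<times> nat \<times> nat \<times> (int \<times> nat) list" where "D = from_nat"
  define s where "s k = (case D k of (p, i, m, l) \<Rightarrow> t i)" for k
  define d where "d k = (case D k of (p, i, m, l) \<Rightarrow> E m l)" for k
  show ?thesis
  proof (rule that)
    show "s k \<in> S" for k by (simp add: s_def t(1) split: prod.split)
    show "cmod (d k \<tau>) \<le> 1" for k \<tau> by (simp add: d_def E_le split: prod.split)
    fix z F and c :: "real \<Rightarrow> complex" and e :: real and K :: nat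
    assume *: "z \<in> S" "finite F" "\<forall>\<tau>\<in>F. cmod (c \<tau>) \<le> 1" "e > 0"
    obtain i where i: "dist (t i) z < e" using t(2) * by blast
    obtain m l where ml: "\<forall>\<tau>\<in>F. dist (E m l \<tau>) (c \<tau>) < e" using E_dense * by meson
    have "inj (\<lambda>p. to_nat (p, i, m, l))" by (auto intro!: injI)
    then have "infinite (range (\<lambda>p::nat. to_nat (p, i, m, l)))"
      by (rule range_inj_infinite)
    then obtain p where "to_nat (p::nat, i, m, l) \<ge> K"
      unfolding infinite_nat_iff_unbounded_le by blast
    moreover have "D (to_nat (p, i, m, l)) = (p, i, m, l)" by (simp add: D_def)
    ultimately show "\<exists>k\<ge>K. dist (s k) z < e \<and> (\<forall>\<tau>\<in>F. dist (d k \<tau>) (c \<tau>) < e)"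
      using i ml by (intro exI[of _ "to_nat (p, i, m, l)"]) (simp add: s_def d_def)
  qed
qed

text \<open>
  Interpolate the coordinates \<open>k \<mapsto> d k \<tau>\<close> of the dense family at points near the \<open>s k\<close>.  A
  subsequence of these points, chosen to suit \<open>z\<close> and \<open>c\<close>, does what is claimed for all \<open>\<tau>\<close> in \<open>F\<close>
  at once, since the points are the same for all \<open>\<tau>\<close>.
\<close>

lemma exists_universal_cluster_family:
  fixes N :: "complex ^ 'n \<Rightarrow> real"
  assumes N: "is_cnorm N"
  obtains f :: "real \<Rightarrow> complex ^ 'n \<Rightarrow> complex" where
    "\<And>\<tau>. f \<tau> \<in> Hinf (norm_ball N)"
    "\<And>z F c. z \<in> norm_sphere N \<Longrightarrow> finite F \<Longrightarrow> \<forall>\<tau>\<in>F. cmod (c \<tau>) \<le> 1 \<Longrightarrow>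
      \<exists>y. (\<forall>j::nat. y j \<in> norm_ball N) \<and> y \<longlonglongrightarrow> z \<and> (\<forall>\<tau>\<in>F. (\<lambda>j. f \<tau> (y j)) \<longlonglongrightarrow> c \<tau>)"
proof -
  obtain s and d :: "nat \<Rightarrow> real \<Rightarrow> complex" where
    s: "\<And>k. s k \<in> norm_sphere N" and d: "\<And>k \<tau>. cmod (d k \<tau>) \<le> 1" and
    dense: "\<And>z F c e K. z \<in> norm_sphere N \<Longrightarrow> finite F \<Longrightarrow> \<forall>\<tau>\<in>F. cmod (c \<tau>) \<le> 1 \<Longrightarrow> e > 0 \<Longrightarrow>
       \<exists>k\<ge>K. dist (s k) z < e \<and> (\<forall>\<tau>\<in>F. dist (d k \<tau>) (c \<tau>) < e)"
    using dense_family[OF norm_sphere_nonempty[OF N]] by metis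
  obtain x and T :: "(nat \<Rightarrow> complex) \<Rightarrow> complex ^ 'n \<Rightarrow> complex" where
    x: "\<And>k. x k \<in> norm_ball N" "(\<lambda>k. x k - s k) \<longlonglongrightarrow> 0" and
    T: "\<And>d. \<forall>k. cmod (d k) \<le> 1 \<Longrightarrow> T d \<in> Hinf (norm_ball N)"
    "\<And>d. \<forall>k. cmod (d k) \<le> 1 \<Longrightarrow> (\<lambda>k. T d (x k) - d k) \<longlonglongrightarrow> 0"
    using asymptotic_interpolation[OF N, of s] s by (auto simp: norm_sphere_def)
  define f where "f \<tau> = T (\<lambda>k. d k \<tau>)" for \<tau>
  show ?thesis
  proof (rule that)
    show "f \<tau> \<in> Hinf (norm_ball N)" for \<tau> unfolding f_def by (rule T(1)) (simp add: d)
    fix z F and c :: "real \<Rightarrow> complex"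
    assume *: "z \<in> norm_sphere N" "finite F" "\<forall>\<tau>\<in>F. cmod (c \<tau>) \<le> 1"
    have "\<forall>j. \<exists>k\<ge>j. dist (s k) z < 1 / Suc j \<and> (\<forall>\<tau>\<in>F. dist (d k \<tau>) (c \<tau>) < 1 / Suc j)"
      using dense[OF *] by simp
    then obtain \<kappa> where \<kappa>: "\<And>j. \<kappa> j \<ge> j" "\<And>j. dist (s (\<kappa> j)) z < 1 / Suc j"
      "\<And>j \<tau>. \<tau> \<in> F \<Longrightarrow> dist (d (\<kappa> j) \<tau>) (c \<tau>) < 1 / Suc j"
      by metis
    have inf: "filterlim \<kappa> at_top sequentially"
      by (rule filterlim_at_top_mono[OF filterlim_ident]) (simp add: \<kappa>(1))
    have null: "(\<lambda>j. 1 / real (Suc j)) \<longlonglongrightarrow> 0" by (rule LIMSEQ_Suc[OF lim_1_over_n])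
    have "(\<lambda>j. s (\<kappa> j)) \<longlonglongrightarrow> z"
      by (rule metric_tendsto_imp_tendsto[OF null]) (use \<kappa>(2) in \<open>simp add: less_imp_le\<close>)
    from tendsto_add[OF filterlim_compose[OF x(2) inf] this] have y: "(\<lambda>j. x (\<kappa> j)) \<longlonglongrightarrow> z"
      by simp
    have "(\<lambda>j. f \<tau> (x (\<kappa> j))) \<longlonglongrightarrow> c \<tau>" if "\<tau> \<in> F" for \<tau>
    proof -
      have "(\<lambda>j. d (\<kappa> j) \<tau>) \<longlonglongrightarrow> c \<tau>"
        by (rule metric_tendsto_imp_tendsto[OF null]) (use \<kappa>(3)[OF that] in \<open>simp add: less_imp_le\<close>)
      have "(\<lambda>k. f \<tau> (x k) - d k \<tau>) \<longlonglongrightarrow> 0"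
        unfolding f_def by (rule T(2)) (simp add: d)
      from tendsto_add[OF filterlim_compose[OF this inf] \<open>(\<lambda>j. d (\<kappa> j) \<tau>) \<longlonglongrightarrow> c \<tau>\<close>]
      show ?thesis by simp
    qed
    with x(1) y show "\<exists>y. (\<forall>j::nat. y j \<in> norm_ball N) \<and> y \<longlonglongrightarrow> z \<and> (\<forall>\<tau>\<in>F. (\<lambda>j. f \<tau> (y j)) \<longlonglongrightarrow> c \<tau>)"
      by (intro exI[of _ "\<lambda>j. x (\<kappa> j)"]) auto
  qed
qed

section \<open>Polynomial values\<close>

lemma poly_val_cong:
  assumes "Q \<in> polys_in n" "\<And>i. i < n \<Longrightarrow> a i = b i"
  shows "poly_val Q a = poly_val Q b"
proof -
  have "i < n" if "m \<in> Poly_Mapping.keys Q" "i \<in> Poly_Mapping.keys m" for m i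
    using assms(1) that by (auto simp: polys_in_def)
  then show ?thesis
    unfolding poly_val_def by (intro sum.cong arg_cong2[where f = "(*)"] prod.cong) (simp_all add: assms(2))
qed

lemma poly_val_0: "poly_val Q (\<lambda>i. 0) = Poly_Mapping.lookup Q 0"
proof -
  have "poly_val Q (\<lambda>i. 0) =
    (\<Sum>m\<in>Poly_Mapping.keys Q. if m = 0 then Poly_Mapping.lookup Q 0 else 0)"
    unfolding poly_val_def
  proof (intro sum.cong refl)
    fix m :: "nat \<Rightarrow>\<^sub>0 nat"
    show "Poly_Mapping.lookup Q m * (\<Prod>i\<in>Poly_Mapping.keys m. 0 ^ Poly_Mapping.lookup m i) =
      (if m = 0 then Poly_Mapping.lookup Q 0 else 0)"
    proof (cases "m = 0")
      case False
      then obtain i where "i \<in> Poly_Mapping.keys m" by fastforce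
      then have "(\<Prod>i\<in>Poly_Mapping.keys m. 0 ^ Poly_Mapping.lookup m i) = (0::complex)"
        by (intro prod_zero) (auto simp: in_keys_iff)
      then show ?thesis using False by simp
    qed simp
  qed
  also have "\<dots> = Poly_Mapping.lookup Q 0"
    by (simp add: sum.delta in_keys_iff)
  finally show ?thesis .
qed

lemma tendsto_poly_val:
  assumes "Q \<in> polys_in n" "\<And>i. i < n \<Longrightarrow> ((\<lambda>k. a k i) \<longlongrightarrow> b i) G"
  shows "((\<lambda>k. poly_val Q (a k)) \<longlongrightarrow> poly_val Q b) G"
  using assms unfolding poly_val_def polys_in_def
  by (intro tendsto_intros) auto

lemma base_expansion_unique:
  fixes f g :: "nat \<Rightarrow> nat"
  assumes "\<And>i. i < n \<Longrightarrow> f i < D" "\<And>i. i < n \<Longrightarrow> g i < D"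
    and "(\<Sum>i<n. f i * D ^ i) = (\<Sum>i<n. g i * D ^ i)" and "i < n"
  shows "f i = g i"
  using assms
proof (induction n arbitrary: f g i)
  case (Suc n)
  have shift: "(\<Sum>i<Suc n. f i * D ^ i) = f 0 + D * (\<Sum>i<n. f (Suc i) * D ^ i)" for f
    unfolding sum.lessThan_Suc_shift by (simp add: sum_distrib_left algebra_simps)
  have D: "f 0 < D" "g 0 < D" using Suc.prems(1,2)[of 0] by auto
  have eq: "f 0 + D * (\<Sum>i<n. f (Suc i) * D ^ i) = g 0 + D * (\<Sum>i<n. g (Suc i) * D ^ i)"
    using Suc.prems(3) unfolding shift .
  from arg_cong[OF eq, of "\<lambda>x. x mod D"] D have 0: "f 0 = g 0" by simp
  then have "(\<Sum>i<n. f (Suc i) * D ^ i) = (\<Sum>i<n. g (Suc i) * D ^ i)"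
    using eq D by simp
  then have "f (Suc j) = g (Suc j)" if "j < n" for j
    using Suc.IH[of "\<lambda>i. f (Suc i)" "\<lambda>i. g (Suc i)" j] Suc.prems(1,2) that by simp
  with 0 Suc.prems(4) show ?case by (cases i) auto
qed simp

text \<open>
  Kronecker's substitution: putting \<open>u ^ (D ^ i)\<close> for the \<open>i\<close>-th variable, with \<open>D\<close> larger than all
  exponents, sends distinct monomials to distinct powers of \<open>u\<close>, because exponents become digits to
  base \<open>D\<close>.  The result is a nonzero polynomial in \<open>u\<close>, which has finitely many roots.
\<close>

lemma poly_val_nonzero_on_unit_polydisc:
  assumes Q: "Q \<in> polys_in n" "Q \<noteq> 0"
  obtains a where "\<And>i. cmod (a i) \<le> 1" "poly_val Q a \<noteq> 0"
proof -
  let ?K = "Poly_Mapping.keys Q"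
  have keys: "Poly_Mapping.keys m \<subseteq> {..<n}" if "m \<in> ?K" for m
    using Q(1) that by (auto simp: polys_in_def)
  define D where "D = Suc (\<Sum>m\<in>?K. \<Sum>i<n. Poly_Mapping.lookup m i)"
  have D: "Poly_Mapping.lookup m i < D" if "m \<in> ?K" "i < n" for m i
  proof -
    have "Poly_Mapping.lookup m i \<le> (\<Sum>i<n. Poly_Mapping.lookup m i)"
      using that by (intro member_le_sum) auto
    also have "\<dots> \<le> (\<Sum>m\<in>?K. \<Sum>i<n. Poly_Mapping.lookup m i)"
      using that by (intro member_le_sum[where f = "\<lambda>m. \<Sum>i<n. Poly_Mapping.lookup m i"]) auto
    finally show ?thesis by (simp add: D_def)
  qed
  define e where "e m = (\<Sum>i<n. Poly_Mapping.lookup m i * D ^ i)" for m :: "nat \<Rightarrow>\<^sub>0 nat"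
  have inj: "inj_on e ?K"
  proof (rule inj_onI, rule poly_mapping_eqI)
    fix m m' i assume m: "m \<in> ?K" "m' \<in> ?K" "e m = e m'"
    show "Poly_Mapping.lookup m i = Poly_Mapping.lookup m' i"
    proof (cases "i < n")
      case True
      with m D show ?thesis
        by (intro base_expansion_unique[of n "Poly_Mapping.lookup m" D "Poly_Mapping.lookup m'"])
          (auto simp: e_def)
    next
      case False
      then have "i \<notin> Poly_Mapping.keys m" "i \<notin> Poly_Mapping.keys m'" using keys m by blast+
      then show ?thesis by (simp add: in_keys_iff)
    qed
  qed
  define p where "p = (\<Sum>m\<in>?K. monom (Poly_Mapping.lookup Q m) (e m))"
  have p: "poly p u = poly_val Q (\<lambda>i. u ^ (D ^ i))" for u
  proof -
    have "u ^ e m = (\<Prod>i\<in>Poly_Mapping.keys m. (u ^ (D ^ i)) ^ Poly_Mapping.lookup m i)"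
      if "m \<in> ?K" for m
    proof -
      have "u ^ e m = (\<Prod>i<n. (u ^ (D ^ i)) ^ Poly_Mapping.lookup m i)"
        by (simp add: e_def power_sum mult.commute flip: power_mult)
      also have "\<dots> = (\<Prod>i\<in>Poly_Mapping.keys m. (u ^ (D ^ i)) ^ Poly_Mapping.lookup m i)"
        using keys[OF that] by (intro prod.mono_neutral_right) (auto simp: in_keys_iff)
      finally show ?thesis .
    qed
    then show ?thesis by (simp add: p_def poly_sum poly_monom poly_val_def)
  qed
  obtain m where m: "m \<in> ?K" using Q(2) by fastforce
  have "coeff p (e m) = (\<Sum>m'\<in>?K. if m' = m then Poly_Mapping.lookup Q m' else 0)"
    unfolding p_def coeff_sum coeff_monom
    using inj m by (intro sum.cong) (auto dest: inj_onD)
  also have "\<dots> = Poly_Mapping.lookup Q m" using m by simp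
  finally have "p \<noteq> 0" using m by (auto simp: in_keys_iff)
  then have "finite {u. poly p u = 0}" by (rule poly_roots_finite)
  moreover have "infinite (ball (0::complex) 1)"
    by (intro uncountable_infinite uncountable_ball) simp
  ultimately obtain u where u: "u \<in> ball 0 1" "poly p u \<noteq> 0"
    by (metis (mono_tags, lifting) infinite_super mem_Collect_eq subsetI)
  show ?thesis
    by (rule that[of "\<lambda>i. u ^ (D ^ i)"]) (use u p in \<open>auto simp: norm_power power_le_one\<close>)
qed

text \<open>
  As a function of \<open>u\<close> the value at \<open>u * c\<close> is entire, \<open>0\<close> at \<open>u = 0\<close> and nonzero at \<open>u = 1\<close>, so the
  open mapping theorem applies to it.
\<close>

lemma poly_val_scaled_covers_ball:
  assumes Q: "Q \<in> polys_in n" "Poly_Mapping.lookup Q 0 = 0" and c: "poly_val Q c \<noteq> 0"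
  obtains r where "r > 0"
    "\<And>w. w \<in> ball 0 r \<Longrightarrow> \<exists>u. (\<forall>i<n. cmod (u * c i) \<le> 1) \<and> poly_val Q (\<lambda>i. u * c i) = w"
proof -
  define p where "p u = poly_val Q (\<lambda>i. u * c i)" for u
  \<comment> \<open>\<open>\<bar>u\<bar> < 1 / C\<close> keeps all \<open>u * c i\<close> in the closed unit disc\<close>
  define C where "C = 1 + (\<Sum>i<n. cmod (c i))"
  have C: "C > 0" unfolding C_def by (intro add_pos_nonneg sum_nonneg) auto
  have p0: "p 0 = 0" using poly_val_0[of Q] Q(2) by (simp add: p_def)
  have "p 1 \<noteq> 0" using c by (simp add: p_def)
  then have "\<not> p constant_on UNIV" using p0 unfolding constant_on_def by (metis UNIV_I)
  moreover have "p holomorphic_on UNIV"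
    unfolding p_def poly_val_def by (intro holomorphic_intros)
  ultimately have "open (p ` ball 0 (1 / C))"
    by (intro open_mapping_thm[of p UNIV]) auto
  moreover have "0 \<in> p ` ball 0 (1 / C)" using p0 C by (intro image_eqI[of _ _ 0]) auto
  ultimately obtain r where r: "r > 0" "ball 0 r \<subseteq> p ` ball 0 (1 / C)"
    unfolding open_contains_ball by blast
  have "cmod (u * c i) \<le> 1" if u: "u \<in> ball 0 (1 / C)" and i: "i < n" for u i
  proof -
    have "cmod (c i) \<le> (\<Sum>i<n. cmod (c i))" using i by (intro member_le_sum) auto
    then have "cmod (c i) \<le> C" by (simp add: C_def)
    then have "cmod (u * c i) \<le> (1 / C) * C"
      unfolding norm_mult using u C by (intro mult_mono) auto
    then show ?thesis using C by simp
  qed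
  then show ?thesis using that[OF r(1)] r(2) unfolding p_def by blast
qed

lemma poly_fun_in_Hinf:
  assumes "open B" and Q: "Q \<in> polys_in n" and g: "\<And>i. i < n \<Longrightarrow> g i \<in> Hinf B"
  shows "poly_fun B Q g \<in> Hinf B"
proof -
  have keys: "i < n" if "m \<in> Poly_Mapping.keys Q" "i \<in> Poly_Mapping.keys m" for m i
    using Q that by (auto simp: polys_in_def)
  have "cn_holomorphic_on (\<lambda>x. poly_val Q (\<lambda>i. g i x)) B"
    unfolding poly_val_def using g keys
    by (intro cn_holomorphic_on_sum cn_holomorphic_on_mult cn_holomorphic_on_const
        cn_holomorphic_on_prod cn_holomorphic_on_power) (auto simp: Hinf_def)
  then have "cn_holomorphic_on (poly_fun B Q g) B"
    by (rule cn_holomorphic_on_cong_open[OF _ \<open>open B\<close>]) (simp add: poly_fun_def)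
  moreover have "\<forall>i. \<exists>b. i < n \<longrightarrow> (\<forall>x\<in>B. cmod (g i x) \<le> b)"
    using g by (auto simp: Hinf_def bounded_iff)
  then obtain b where b: "\<And>i x. i < n \<Longrightarrow> x \<in> B \<Longrightarrow> cmod (g i x) \<le> b i" by metis
  have "cmod (poly_fun B Q g x) \<le> (\<Sum>m\<in>Poly_Mapping.keys Q.
      cmod (Poly_Mapping.lookup Q m) * (\<Prod>i\<in>Poly_Mapping.keys m. b i ^ Poly_Mapping.lookup m i))"
    if x: "x \<in> B" for x
    using x unfolding poly_fun_def poly_val_def
    by (auto intro!: sum_norm_le mult_left_mono prod_mono power_mono b keys
        simp: norm_mult norm_power simp flip: prod_norm)
  then have "bounded (poly_fun B Q g ` B)" unfolding bounded_iff by blast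
  ultimately show ?thesis by (simp add: Hinf_def poly_fun_def)
qed

section \<open>Strong algebrability\<close>

theorem theorem1p1:
  fixes N :: "complex ^ 'n \<Rightarrow> real"
  assumes "is_cnorm N"
  shows "strongly_algebrable |UNIV :: real set| (norm_ball N) (Hinf (norm_ball N))
    {f \<in> Hinf (norm_ball N). \<exists>r>0. \<forall>z\<in>norm_sphere N. ball 0 r \<subseteq> cluster_set (norm_ball N) f z}"
proof -
  let ?B = "norm_ball N"
  obtain f :: "real \<Rightarrow> complex ^ 'n \<Rightarrow> complex" where f: "\<And>\<tau>. f \<tau> \<in> Hinf ?B" and
    cluster: "\<And>z F c. z \<in> norm_sphere N \<Longrightarrow> finite F \<Longrightarrow> \<forall>\<tau>\<in>F. cmod (c \<tau>) \<le> 1 \<Longrightarrow>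
      \<exists>y. (\<forall>j::nat. y j \<in> ?B) \<and> y \<longlonglongrightarrow> z \<and> (\<forall>\<tau>\<in>F. (\<lambda>j. f \<tau> (y j)) \<longlonglongrightarrow> c \<tau>)"
    using exists_universal_cluster_family[OF assms] by metis
  \<comment> \<open>Variables may share a generator here: targets belong to indices \<open>\<tau>\<close>, not to variables.\<close>
  have poly_cluster: "poly_val Q (\<lambda>i. c (t i)) \<in> cluster_set ?B (poly_fun ?B Q g) z"
    if z: "z \<in> norm_sphere N" and Q: "Q \<in> polys_in n" and g: "\<And>i. i < n \<Longrightarrow> g i = f (t i)"
      and c: "\<And>i. i < n \<Longrightarrow> cmod (c (t i)) \<le> 1" for z Q n g t c
  proof -
    obtain y where y: "\<And>j::nat. y j \<in> ?B" "y \<longlonglongrightarrow> z"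
      "\<And>\<tau>. \<tau> \<in> t ` {..<n} \<Longrightarrow> (\<lambda>j. f \<tau> (y j)) \<longlonglongrightarrow> c \<tau>"
      using cluster[OF z, of "t ` {..<n}" c] c by auto
    have "(\<lambda>j. poly_val Q (\<lambda>i. g i (y j))) \<longlonglongrightarrow> poly_val Q (\<lambda>i. c (t i))"
      using y(3) g by (intro tendsto_poly_val[OF Q]) auto
    with y(1,2) show ?thesis
      unfolding cluster_set_def poly_fun_def by (auto intro!: exI[of _ y])
  qed
  obtain z where z: "z \<in> norm_sphere N" using norm_sphere_nonempty[OF assms] by blast
  have inj: "inj f"
  proof (rule injI, rule ccontr)
    fix \<tau> \<sigma> assume eq: "f \<tau> = f \<sigma>" and ne: "\<tau> \<noteq> \<sigma>"
    obtain y where "\<forall>\<upsilon>\<in>{\<tau>, \<sigma>}. (\<lambda>j. f \<upsilon> (y j)) \<longlonglongrightarrow> (if \<upsilon> = \<tau> then 1 else 0)"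
      using ne[symmetric] cluster[OF z, of "{\<tau>, \<sigma>}" "\<lambda>\<upsilon>. if \<upsilon> = \<tau> then 1 else 0"] by auto
    then have "(\<lambda>j. f \<tau> (y j)) \<longlonglongrightarrow> 1" "(\<lambda>j. f \<tau> (y j)) \<longlonglongrightarrow> 0"
      using eq ne by auto
    then show False using LIMSEQ_unique zero_neq_one by metis
  qed
  have card: "|range f| =o |UNIV :: real set|"
    using card_of_ordIsoI[OF bij_betw_imageI[OF inj refl]] by (rule ordIso_symmetric)
  have indep: "alg_independent ?B (range f)"
    unfolding alg_independent_def
  proof (intro allI ballI impI, elim conjE)
    fix n Q and g :: "nat \<Rightarrow> complex ^ 'n \<Rightarrow> complex"
    assume Q: "Q \<in> polys_in n" and g: "inj_on g {..<n}" "g ` {..<n} \<subseteq> range f"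
      and zero: "poly_fun ?B Q g = (\<lambda>x\<in>?B. 0)"
    define t where "t i = inv f (g i)" for i
    have t: "g i = f (t i)" if "i < n" for i
      using g(2) that unfolding t_def by (metis f_inv_into_f image_subset_iff lessThan_iff)
    have t_inj: "inj_on t {..<n}"
      using g(1) t unfolding inj_on_def by (metis lessThan_iff)
    show "Q = 0"
    proof (rule ccontr)
      assume "Q \<noteq> 0"
      then obtain a where a: "\<And>i. cmod (a i) \<le> 1" "poly_val Q a \<noteq> 0"
        using poly_val_nonzero_on_unit_polydisc[OF Q] by blast
      \<comment> \<open>the indices are distinct, so the targets can realise any point \<open>a\<close> of the polydisc\<close>
      define c where "c \<tau> = a (the_inv_into {..<n} t \<tau>)" for \<tau>
      have c: "c (t i) = a i" if "i < n" for i
        using the_inv_into_f_f[OF t_inj] that by (simp add: c_def)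
      have "poly_val Q (\<lambda>i. c (t i)) \<in> cluster_set ?B (poly_fun ?B Q g) z"
        by (rule poly_cluster[OF z Q t]) (auto simp: c_def a(1))
      also have "poly_val Q (\<lambda>i. c (t i)) = poly_val Q a"
        by (rule poly_val_cong[OF Q c])
      finally obtain y where y: "\<And>k. y k \<in> ?B" "(\<lambda>k. poly_fun ?B Q g (y k)) \<longlonglongrightarrow> poly_val Q a"
        unfolding cluster_set_def by blast
      have "(\<lambda>k. poly_fun ?B Q g (y k)) = (\<lambda>k. 0)" using y(1) zero by simp
      then show False using y(2) a(2) LIMSEQ_const_iff by metis
    qed
  qed
  have gen: "p \<in> {f \<in> Hinf ?B. \<exists>r>0. \<forall>z\<in>norm_sphere N. ball 0 r \<subseteq> cluster_set ?B f z} \<union> {\<lambda>x\<in>?B. 0}"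
    if mem: "p \<in> generated_subalgebra ?B (range f)" for p
  proof (cases "p = (\<lambda>x\<in>?B. 0)")
    case False
    obtain n Q g where p: "p = poly_fun ?B Q g" and Q: "Q \<in> polys_in n" "Poly_Mapping.lookup Q 0 = 0"
      and g: "g ` {..<n} \<subseteq> range f"
      using mem unfolding generated_subalgebra_def by blast
    define t where "t i = inv f (g i)" for i
    have t: "g i = f (t i)" if "i < n" for i
      using g that unfolding t_def by (metis f_inv_into_f image_subset_iff lessThan_iff)
    have "p \<in> Hinf ?B"
      unfolding p using t f by (intro poly_fun_in_Hinf[OF open_norm_ball[OF assms] Q(1)]) simp
    obtain x where "poly_val Q (\<lambda>i. g i x) \<noteq> 0"
      using False unfolding p poly_fun_def by (metis restrict_ext)
    moreover have "poly_val Q (\<lambda>i. g i x) = poly_val Q (\<lambda>i. f (t i) x)"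
      by (rule poly_val_cong[OF Q(1)]) (simp add: t)
    ultimately have "poly_val Q (\<lambda>i. f (t i) x) \<noteq> 0" by simp
    then obtain r where r: "r > 0" "\<And>w. w \<in> ball 0 r \<Longrightarrow>
        \<exists>u. (\<forall>i<n. cmod (u * f (t i) x) \<le> 1) \<and> poly_val Q (\<lambda>i. u * f (t i) x) = w"
      using poly_val_scaled_covers_ball[OF Q] by metis
    have "w \<in> cluster_set ?B p z" if z: "z \<in> norm_sphere N" and w: "w \<in> ball 0 r" for z w
    proof -
      obtain u where u: "\<forall>i<n. cmod (u * f (t i) x) \<le> 1" "poly_val Q (\<lambda>i. u * f (t i) x) = w"
        using r(2)[OF w] by blast
      have "poly_val Q (\<lambda>i. u * f (t i) x) \<in> cluster_set ?B (poly_fun ?B Q g) z"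
        by (rule poly_cluster[OF z Q(1), where t = t and c = "\<lambda>\<tau>. u * f \<tau> x"])
          (use t u(1) in auto)
      then show ?thesis by (simp add: u(2) p)
    qed
    with \<open>p \<in> Hinf ?B\<close> r(1) show ?thesis by blast
  qed simp
  show ?thesis
    unfolding strongly_algebrable_def
  proof (intro conjI exI[of _ "range f"])
    show "infinite (range f)" by (simp add: finite_image_iff[OF inj] infinite_UNIV_char_0)
  qed (use f card indep gen in auto)
qed

end
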